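(* Let $k$ be a commutative ring, $A$ a $k$-algebra, $R=R^1\otimes R^2\otimes R^3\in A^{(3)}$ a canonical $R$-matrix for $A$, and $V$ an $A$-bimodule. Then the map $$\Omega:V\otimes V\to V\otimes V,\qquad \Omega(v\otimes w)=R^1wR^2\otimes R^3v$$ is a solution of the quantum Yang–Baxter equation $\Omega^{12}\Omega^{13}\Omega^{23}=\Omega^{23}\Omega^{13}\Omega^{12}$ and of the braid equation $\Omega^{12}\Omega^{23}\Omega^{12}=\Omega^{23}\Omega^{12}\Omega^{23}$ (both in $\mathrm{End}_k(V\otimes V\otimes V)$). Moreover $\Omega^3=\Omega$ in $\mathrm{End}_k(V\otimes V)$.
   Context: Algebras are associative and unital. $\otimes=\otimes_k$, and $A^{(n)}=A\otimes\cdots\otimes A$ ($n$ factors), with its tensor product algebra structure. $A$-bimodules are $k$-linear (left and right $k$-actions agree). An element $R\in A^{(3)}$ is written $R=R^1\otimes R^2\otimes R^3$ with summation implicitly understood. A canonical $R$-matrix for $A$ is an invertible element $R$ of the algebra $A^{(3)}$ such that, with $r=r^1\otimes r^2\otimes r^3$ a second copy of $R$, for all $a\in A$: $R^1\otimes R^2\otimes aR^3=R^1a\otimes R^2\otimes R^3$; $aR^1\otimes R^2\otimes R^3=R^1\otimes R^2a\otimes R^3$; $R^1\otimes aR^2\otimes R^3=R^1\otimes R^2\otimes R^3a$; $R^1\otimes R^2\otimes 1\otimes R^3=r^1R^1\otimes r^2\otimes r^3R^2\otimes R^3$; $R^1\otimes 1\otimes R^2\otimes R^3=R^1\otimes R^2r^1\otimes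 r^2\otimes R^3r^3$. $\Omega^{ij}$ denotes the endomorphism of $V\otimes V\otimes V$ acting as $\Omega$ on the $i$-th and $j$-th tensor factors and as the identity on the remaining one; products are compositions. *)

theory Defs
  imports "HOL-Algebra.Module" "HOL-Algebra.AbelCoset"
begin

text \<open>
  The locale \<^locale>\<open>algebra\<close> of the library requires the algebra to be commutative; this is its
  associative unital, not necessarily commutative version. \<open>R\<close> is the ground ring.
\<close>

locale assoc_algebra = module R M + ring M for R (structure) and M (structure) +
  assumes smult_mult_left:
      "\<lbrakk>c \<in> carrier R; x \<in> carrier M; y \<in> carrier M\<rbrakk> \<Longrightarrow>
        c \<odot>\<^bsub>M\<^esub> (x \<otimes>\<^bsub>M\<^esub> y) = (c \<odot>\<^bsub>M\<^esub> x) \<otimes>\<^bsub>M\<^esub> y"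
    and smult_mult_right:
      "\<lbrakk>c \<in> carrier R; x \<in> carrier M; y \<in> carrier M\<rbrakk> \<Longrightarrow>
        c \<odot>\<^bsub>M\<^esub> (x \<otimes>\<^bsub>M\<^esub> y) = x \<otimes>\<^bsub>M\<^esub> (c \<odot>\<^bsub>M\<^esub> y)"

text \<open>
  An \<open>A\<close>-bimodule over the ground ring \<open>k\<close>, with left action \<open>l a v\<close> and right action \<open>r v a\<close>.
  The last two assumptions say that the \<open>k\<close>-module structure of \<open>V\<close> is the one induced by
  the left action and also the one induced by the right action.
\<close>

locale bimodule = A: assoc_algebra k A + V: module k V
  for k :: "('k, 'x) ring_scheme" and A :: "('k, 'a, 'y) module_scheme"
    and V :: "('k, 'v, 'z) module_scheme" +
  fixes l :: "'a \<Rightarrow> 'v \<Rightarrow> 'v" and r :: "'v \<Rightarrow> 'a \<Rightarrow> 'v"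
  assumes l_closed: "\<lbrakk>a \<in> carrier A; v \<in> carrier V\<rbrakk> \<Longrightarrow> l a v \<in> carrier V"
    and r_closed: "\<lbrakk>a \<in> carrier A; v \<in> carrier V\<rbrakk> \<Longrightarrow> r v a \<in> carrier V"
    and l_add_scalar: "\<lbrakk>a \<in> carrier A; b \<in> carrier A; v \<in> carrier V\<rbrakk> \<Longrightarrow>
      l (a \<oplus>\<^bsub>A\<^esub> b) v = l a v \<oplus>\<^bsub>V\<^esub> l b v"
    and r_add_scalar: "\<lbrakk>a \<in> carrier A; b \<in> carrier A; v \<in> carrier V\<rbrakk> \<Longrightarrow>
      r v (a \<oplus>\<^bsub>A\<^esub> b) = r v a \<oplus>\<^bsub>V\<^esub> r v b"
    and l_add: "\<lbrakk>a \<in> carrier A; v \<in> carrier V; w \<in> carrier V\<rbrakk> \<Longrightarrow>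
      l a (v \<oplus>\<^bsub>V\<^esub> w) = l a v \<oplus>\<^bsub>V\<^esub> l a w"
    and r_add: "\<lbrakk>a \<in> carrier A; v \<in> carrier V; w \<in> carrier V\<rbrakk> \<Longrightarrow>
      r (v \<oplus>\<^bsub>V\<^esub> w) a = r v a \<oplus>\<^bsub>V\<^esub> r w a"
    and l_assoc: "\<lbrakk>a \<in> carrier A; b \<in> carrier A; v \<in> carrier V\<rbrakk> \<Longrightarrow>
      l (a \<otimes>\<^bsub>A\<^esub> b) v = l a (l b v)"
    and r_assoc: "\<lbrakk>a \<in> carrier A; b \<in> carrier A; v \<in> carrier V\<rbrakk> \<Longrightarrow>
      r v (a \<otimes>\<^bsub>A\<^esub> b) = r (r v a) b"
    and l_one: "v \<in> carrier V \<Longrightarrow> l \<one>\<^bsub>A\<^esub> v = v"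
    and r_one: "v \<in> carrier V \<Longrightarrow> r v \<one>\<^bsub>A\<^esub> = v"
    and l_r_assoc: "\<lbrakk>a \<in> carrier A; b \<in> carrier A; v \<in> carrier V\<rbrakk> \<Longrightarrow>
      r (l a v) b = l a (r v b)"
    and l_central: "\<lbrakk>c \<in> carrier k; v \<in> carrier V\<rbrakk> \<Longrightarrow> l (c \<odot>\<^bsub>A\<^esub> \<one>\<^bsub>A\<^esub>) v = c \<odot>\<^bsub>V\<^esub> v"
    and r_central: "\<lbrakk>c \<in> carrier k; v \<in> carrier V\<rbrakk> \<Longrightarrow> r v (c \<odot>\<^bsub>A\<^esub> \<one>\<^bsub>A\<^esub>) = c \<odot>\<^bsub>V\<^esub> v"

definition module_hom ::
  "('k, 'x) ring_scheme \<Rightarrow> ('k, 'm, 'y) module_scheme \<Rightarrow> ('k, 'n, 'z) module_scheme \<Rightarrow> ('m \<Rightarrow> 'n) set"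
  where "module_hom k M N = {h \<in> carrier M \<rightarrow> carrier N.
    (\<forall>x\<in>carrier M. \<forall>y\<in>carrier M. h (x \<oplus>\<^bsub>M\<^esub> y) = h x \<oplus>\<^bsub>N\<^esub> h y) \<and>
    (\<forall>c\<in>carrier k. \<forall>x\<in>carrier M. h (c \<odot>\<^bsub>M\<^esub> x) = c \<odot>\<^bsub>N\<^esub> h x)}"

text \<open>
  The module records below that only carry a module structure leave the fields \<^const>\<open>mult\<close>
  and \<^const>\<open>one\<close> unspecified.
\<close>

definition free_module :: "('k, 'x) ring_scheme \<Rightarrow> 's set \<Rightarrow> ('k, 's \<Rightarrow> 'k) module"
  where "free_module k S =
    \<lparr>carrier = {f. range f \<subseteq> carrier k \<and> finite {s. f s \<noteq> \<zero>\<^bsub>k\<^esub>} \<and> {s. f s \<noteq> \<zero>\<^bsub>k\<^esub>} \<subseteq> S},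
     mult = undefined, one = undefined,
     zero = (\<lambda>s. \<zero>\<^bsub>k\<^esub>), add = (\<lambda>f g s. f s \<oplus>\<^bsub>k\<^esub> g s),
     smult = (\<lambda>c f s. c \<otimes>\<^bsub>k\<^esub> f s)\<rparr>"

definition free_gen :: "('k, 'x) ring_scheme \<Rightarrow> 's \<Rightarrow> 's \<Rightarrow> 'k"
  where "free_gen k s = (\<lambda>t. if t = s then \<one>\<^bsub>k\<^esub> else \<zero>\<^bsub>k\<^esub>)"

definition submodule_span ::
  "('k, 'x) ring_scheme \<Rightarrow> ('k, 'm, 'y) module_scheme \<Rightarrow> 'm set \<Rightarrow> 'm set"
  where "submodule_span k M X = \<Inter>{N. submodule N k M \<and> X \<subseteq> N}"

definition quotient_module :: "('k, 'm, 'y) module_scheme \<Rightarrow> 'm set \<Rightarrow> ('k, 'm set) module"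
  where "quotient_module M N =
    \<lparr>carrier = a_rcosets\<^bsub>M\<^esub> N, mult = undefined, one = undefined,
     zero = N, add = set_add M, smult = (\<lambda>c X. \<Union>x\<in>X. N +>\<^bsub>M\<^esub> (c \<odot>\<^bsub>M\<^esub> x))\<rparr>"

text \<open>
  The \<open>n\<close>-fold tensor power \<open>M \<otimes> \<cdots> \<otimes> M\<close> over \<open>k\<close>, without choice of a
  bracketing: the free \<open>k\<close>-module on all lists of length \<open>n\<close> over \<open>M\<close>, modulo multilinearity
  in every position.
\<close>

definition tuples :: "('k, 'm, 'y) module_scheme \<Rightarrow> nat \<Rightarrow> 'm list set"
  where "tuples M n = {xs. length xs = n \<and> set xs \<subseteq> carrier M}"

definition multilinear_rels ::
  "('k, 'x) ring_scheme \<Rightarrow> ('k, 'm, 'y) module_scheme \<Rightarrow> nat \<Rightarrow> ('m list \<Rightarrow> 'k) set"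
  where "multilinear_rels k M n =
    (let F = free_module k (tuples M n) in
      {free_gen k (xs[i := x \<oplus>\<^bsub>M\<^esub> y]) \<ominus>\<^bsub>F\<^esub> (free_gen k (xs[i := x]) \<oplus>\<^bsub>F\<^esub> free_gen k (xs[i := y]))
        | xs i x y. xs \<in> tuples M n \<and> i < n \<and> x \<in> carrier M \<and> y \<in> carrier M} \<union>
      {free_gen k (xs[i := c \<odot>\<^bsub>M\<^esub> x]) \<ominus>\<^bsub>F\<^esub> (c \<odot>\<^bsub>F\<^esub> free_gen k (xs[i := x]))
        | xs i c x. xs \<in> tuples M n \<and> i < n \<and> c \<in> carrier k \<and> x \<in> carrier M})"

definition tensor_kernel ::
  "('k, 'x) ring_scheme \<Rightarrow> ('k, 'm, 'y) module_scheme \<Rightarrow> nat \<Rightarrow> ('m list \<Rightarrow> 'k) set"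
  where "tensor_kernel k M n =
    submodule_span k (free_module k (tuples M n)) (multilinear_rels k M n)"

definition tensor_power ::
  "('k, 'x) ring_scheme \<Rightarrow> ('k, 'm, 'y) module_scheme \<Rightarrow> nat \<Rightarrow> ('k, ('m list \<Rightarrow> 'k) set) module"
  where "tensor_power k M n = quotient_module (free_module k (tuples M n)) (tensor_kernel k M n)"

definition tensor ::
  "('k, 'x) ring_scheme \<Rightarrow> ('k, 'm, 'y) module_scheme \<Rightarrow> 'm list \<Rightarrow> ('m list \<Rightarrow> 'k) set"
  where "tensor k M xs =
    tensor_kernel k M (length xs) +>\<^bsub>free_module k (tuples M (length xs))\<^esub> free_gen k xs"

text \<open>
  For a multilinear \<open>f\<close> into a \<open>k\<close>-module \<open>T\<close>, \<open>tensor_lift k T f\<close> is the induced linear map from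
  the tensor power to \<open>T\<close>: the class of \<open>c\<close> is sent to \<open>\<Sum>\<^sub>x\<^sub>s c(xs) f(xs)\<close>, which does not
  depend on the representative \<open>c\<close>.
  In Sweedler-type notation, \<open>tensor_lift k T f X\<close> is \<open>f(X\<^sup>1, \<dots>, X\<^sup>n)\<close>, summation understood.
\<close>

definition tensor_lift ::
  "('k, 'x) ring_scheme \<Rightarrow> ('k, 't, 'y) module_scheme \<Rightarrow> ('m list \<Rightarrow> 't) \<Rightarrow> ('m list \<Rightarrow> 'k) set \<Rightarrow> 't"
  where "tensor_lift k T f X =
    the_elem ((\<lambda>c. \<Oplus>\<^bsub>T\<^esub>xs\<in>{xs. c xs \<noteq> \<zero>\<^bsub>k\<^esub>}. c xs \<odot>\<^bsub>T\<^esub> f xs) ` X)"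

definition sweedler2 ::
  "('k, 'x) ring_scheme \<Rightarrow> ('k, 't, 'y) module_scheme \<Rightarrow> ('m \<Rightarrow> 'm \<Rightarrow> 't) \<Rightarrow> ('m list \<Rightarrow> 'k) set \<Rightarrow> 't"
  where "sweedler2 k T f X = tensor_lift k T (\<lambda>xs. f (xs ! 0) (xs ! 1)) X"

definition sweedler3 ::
  "('k, 'x) ring_scheme \<Rightarrow> ('k, 't, 'y) module_scheme \<Rightarrow> ('m \<Rightarrow> 'm \<Rightarrow> 'm \<Rightarrow> 't) \<Rightarrow>
    ('m list \<Rightarrow> 'k) set \<Rightarrow> 't"
  where "sweedler3 k T f X = tensor_lift k T (\<lambda>xs. f (xs ! 0) (xs ! 1) (xs ! 2)) X"

definition tensor_power_algebra ::
  "('k, 'x) ring_scheme \<Rightarrow> ('k, 'a, 'y) module_scheme \<Rightarrow> nat \<Rightarrow> ('k, ('a list \<Rightarrow> 'k) set) module"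
  where "tensor_power_algebra k A n =
    (tensor_power k A n)
      \<lparr>mult := (\<lambda>X Y. tensor_lift k (tensor_power k A n) (\<lambda>xs.
          tensor_lift k (tensor_power k A n) (\<lambda>ys. tensor k A (map2 (\<otimes>\<^bsub>A\<^esub>) xs ys)) Y) X),
       one := tensor k A (replicate n \<one>\<^bsub>A\<^esub>)\<rparr>"

definition canonical_R_matrix ::
  "('k, 'x) ring_scheme \<Rightarrow> ('k, 'a, 'y) module_scheme \<Rightarrow> ('a list \<Rightarrow> 'k) set \<Rightarrow> bool"
  where "canonical_R_matrix k A R \<longleftrightarrow>
    (let A3 = tensor_power_algebra k A 3; A4 = tensor_power_algebra k A 4 in
      R \<in> Units A3 \<and>
      (\<forall>a\<in>carrier A.
        sweedler3 k A3 (\<lambda>R1 R2 R3. tensor k A [R1, R2, a \<otimes>\<^bsub>A\<^esub> R3]) R =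
        sweedler3 k A3 (\<lambda>R1 R2 R3. tensor k A [R1 \<otimes>\<^bsub>A\<^esub> a, R2, R3]) R) \<and>
      (\<forall>a\<in>carrier A.
        sweedler3 k A3 (\<lambda>R1 R2 R3. tensor k A [a \<otimes>\<^bsub>A\<^esub> R1, R2, R3]) R =
        sweedler3 k A3 (\<lambda>R1 R2 R3. tensor k A [R1, R2 \<otimes>\<^bsub>A\<^esub> a, R3]) R) \<and>
      (\<forall>a\<in>carrier A.
        sweedler3 k A3 (\<lambda>R1 R2 R3. tensor k A [R1, a \<otimes>\<^bsub>A\<^esub> R2, R3]) R =
        sweedler3 k A3 (\<lambda>R1 R2 R3. tensor k A [R1, R2, R3 \<otimes>\<^bsub>A\<^esub> a]) R) \<and>
      sweedler3 k A4 (\<lambda>R1 R2 R3. tensor k A [R1, R2, \<one>\<^bsub>A\<^esub>, R3]) R =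
      sweedler3 k A4 (\<lambda>r1 r2 r3. sweedler3 k A4 (\<lambda>R1 R2 R3.
        tensor k A [r1 \<otimes>\<^bsub>A\<^esub> R1, r2, r3 \<otimes>\<^bsub>A\<^esub> R2, R3]) R) R \<and>
      sweedler3 k A4 (\<lambda>R1 R2 R3. tensor k A [R1, \<one>\<^bsub>A\<^esub>, R2, R3]) R =
      sweedler3 k A4 (\<lambda>r1 r2 r3. sweedler3 k A4 (\<lambda>R1 R2 R3.
        tensor k A [R1, R2 \<otimes>\<^bsub>A\<^esub> r1, r2, R3 \<otimes>\<^bsub>A\<^esub> r3]) R) R)"

text \<open>The \<open>k\<close>-linear extension of \<open>v \<otimes> w \<mapsto> R\<^sup>1 w R\<^sup>2 \<otimes> R\<^sup>3 v\<close>.\<close>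

definition Omega ::
  "('k, 'x) ring_scheme \<Rightarrow> ('k, 'v, 'z) module_scheme \<Rightarrow> ('a \<Rightarrow> 'v \<Rightarrow> 'v) \<Rightarrow> ('v \<Rightarrow> 'a \<Rightarrow> 'v) \<Rightarrow>
    ('a list \<Rightarrow> 'k) set \<Rightarrow> ('v list \<Rightarrow> 'k) set \<Rightarrow> ('v list \<Rightarrow> 'k) set"
  where "Omega k V l r R =
    sweedler2 k (tensor_power k V 2) (\<lambda>v w.
      sweedler3 k (tensor_power k V 2) (\<lambda>R1 R2 R3. tensor k V [r (l R1 w) R2, l R3 v]) R)"

text \<open>
  For an endomorphism \<open>F\<close> of \<open>V \<otimes> V\<close>, \<open>leg k V i j F\<close> is the endomorphism of \<open>V \<otimes> V \<otimes> V\<close> acting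
  as \<open>F\<close> on the factors \<open>i\<close> and \<open>j\<close>, where \<open>i \<noteq> j\<close> and the factors are numbered 1, 2, 3
  (list positions start at 0).
\<close>

definition leg ::
  "('k, 'x) ring_scheme \<Rightarrow> ('k, 'v, 'z) module_scheme \<Rightarrow> nat \<Rightarrow> nat \<Rightarrow>
    (('v list \<Rightarrow> 'k) set \<Rightarrow> ('v list \<Rightarrow> 'k) set) \<Rightarrow> ('v list \<Rightarrow> 'k) set \<Rightarrow> ('v list \<Rightarrow> 'k) set"
  where "leg k V i j F =
    tensor_lift k (tensor_power k V 3) (\<lambda>us.
      sweedler2 k (tensor_power k V 3) (\<lambda>x y. tensor k V (us[i - 1 := x, j - 1 := y]))
        (F (tensor k V [us ! (i - 1), us ! (j - 1)])))"

end

theory Submission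
  imports Defs
begin

text \<open>
  Write \<open>r\<close> and \<open>s\<close> for further copies of \<open>R\<close>. The first three axioms let an element of \<open>A\<close> travel
  between the components of \<open>R\<close>. Together with the invertibility of \<open>R\<close> they turn the last two axioms
  into the contractions
    \<open>R\<^sup>1R\<^sup>2 \<otimes> R\<^sup>3 = 1 \<otimes> 1\<close>  and  \<open>R\<^sup>3R\<^sup>1 \<otimes> R\<^sup>2 = 1 \<otimes> 1\<close>
  (lemmas \<open>R_first_times_second\<close> and \<open>R_third_times_first\<close>).

  The second axiom says that \<open>R\<^sup>1 w R\<^sup>2 \<otimes> R\<^sup>3\<close> commutes with \<open>A\<close> in the first factor. Hence, by the first
  contraction, \<open>s\<^sup>1 a R\<^sup>1 w R\<^sup>2 s\<^sup>2 \<otimes> s\<^sup>3 \<otimes> R\<^sup>3 = R\<^sup>1 w R\<^sup>2 \<otimes> a \<otimes> R\<^sup>3\<close> (lemma \<open>R_absorb\<close>). In particular \<open>\<Omega>\<close> acts as the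
  flip on \<open>v \<otimes> w\<close> when \<open>w\<close> commutes with \<open>A\<close>, while for any \<open>w\<close> the value \<open>\<Omega>(v \<otimes> w)\<close> commutes with
  \<open>A\<close> in its first factor. In each of the four triple compositions on \<open>V \<otimes> V \<otimes> V\<close> one of the three copies of \<open>R\<close>
  is absorbed in this way. For \<open>u \<otimes> v \<otimes> w\<close> two of the results are
    \<open>R\<^sup>1 w R\<^sup>2 \<otimes> r\<^sup>1R\<^sup>3 v r\<^sup>2 \<otimes> r\<^sup>3 u\<close>  and the other two are  \<open>R\<^sup>1 w R\<^sup>2 \<otimes> r\<^sup>1 v r\<^sup>2 \<otimes> R\<^sup>3r\<^sup>3 u\<close>,
  which are equal by the first axiom. For \<open>\<Omega>\<^sup>3\<close> absorption leaves \<open>R\<^sup>1 w R\<^sup>2 \<otimes> r\<^sup>3r\<^sup>1R\<^sup>3 v r\<^sup>2\<close>, and the second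
  contraction reduces this to \<open>R\<^sup>1 w R\<^sup>2 \<otimes> R\<^sup>3 v\<close>.

  These computations take place inside multilinear maps: an identity \<open>X = Y\<close> in a tensor power is used
  as \<open>f(X) = f(Y)\<close> for all multilinear \<open>f\<close>. This rests on the universal property of the tensor powers,
  proved from their construction as quotients of free modules, and on the fact that an element of a
  tensor power is a finite sum of pure tensors, which turns the Sweedler notation into finite sums that
  commute with linear maps and with each other.
\<close>

section \<open>Linear maps\<close>

lemma module_homI:
  assumes "\<And>x. x \<in> carrier M \<Longrightarrow> h x \<in> carrier N"
    and "\<And>x y. \<lbrakk>x \<in> carrier M; y \<in> carrier M\<rbrakk> \<Longrightarrow> h (x \<oplus>\<^bsub>M\<^esub> y) = h x \<oplus>\<^bsub>N\<^esub> h y"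
    and "\<And>c x. \<lbrakk>c \<in> carrier k; x \<in> carrier M\<rbrakk> \<Longrightarrow> h (c \<odot>\<^bsub>M\<^esub> x) = c \<odot>\<^bsub>N\<^esub> h x"
  shows "h \<in> module_hom k M N"
  using assms by (auto simp: module_hom_def)

lemma module_hom_closed: "\<lbrakk>h \<in> module_hom k M N; x \<in> carrier M\<rbrakk> \<Longrightarrow> h x \<in> carrier N"
  by (auto simp: module_hom_def)

lemma module_hom_add:
  "\<lbrakk>h \<in> module_hom k M N; x \<in> carrier M; y \<in> carrier M\<rbrakk> \<Longrightarrow> h (x \<oplus>\<^bsub>M\<^esub> y) = h x \<oplus>\<^bsub>N\<^esub> h y"
  by (auto simp: module_hom_def)

lemma module_hom_smult:
  "\<lbrakk>h \<in> module_hom k M N; c \<in> carrier k; x \<in> carrier M\<rbrakk> \<Longrightarrow> h (c \<odot>\<^bsub>M\<^esub> x) = c \<odot>\<^bsub>N\<^esub> h x"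
  by (auto simp: module_hom_def)

lemma module_hom_cong:
  assumes "h \<in> module_hom k M N" "module k M" "\<And>x. x \<in> carrier M \<Longrightarrow> h x = g x"
  shows "g \<in> module_hom k M N"
proof -
  interpret module k M by fact
  show ?thesis using assms(1) by (auto simp: module_hom_def assms(3) Pi_def simp flip: assms(3))
qed

lemma module_hom_id: "(\<lambda>x. x) \<in> module_hom k M M"
  by (auto simp: module_hom_def)

lemma module_hom_comp:
  "\<lbrakk>g \<in> module_hom k M N; h \<in> module_hom k N P\<rbrakk> \<Longrightarrow> (\<lambda>x. h (g x)) \<in> module_hom k M P"
  by (auto simp: module_hom_def Pi_def)

lemma module_hom_zero:
  assumes "h \<in> module_hom k M N" "module k M" "module k N"
  shows "h \<zero>\<^bsub>M\<^esub> = \<zero>\<^bsub>N\<^esub>"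
proof -
  interpret M: module k M by fact
  interpret N: module k N by fact
  have "h (\<zero>\<^bsub>k\<^esub> \<odot>\<^bsub>M\<^esub> \<zero>\<^bsub>M\<^esub>) = \<zero>\<^bsub>k\<^esub> \<odot>\<^bsub>N\<^esub> h \<zero>\<^bsub>M\<^esub>"
    by (rule module_hom_smult[OF assms(1)]) auto
  then show ?thesis using assms(1) by (simp add: module_hom_closed)
qed

lemma module_hom_finsum:
  assumes "h \<in> module_hom k M N" "module k M" "module k N" "\<And>i. i \<in> I \<Longrightarrow> f i \<in> carrier M"
  shows "h (\<Oplus>\<^bsub>M\<^esub>i\<in>I. f i) = (\<Oplus>\<^bsub>N\<^esub>i\<in>I. h (f i))"
proof -
  interpret M: module k M by fact
  interpret N: module k N by fact
  show ?thesis using assms(4)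
  proof (induction I rule: infinite_finite_induct)
    case (insert x F)
    then show ?case using assms(1) by (simp add: Pi_def module_hom_closed module_hom_add)
  qed (simp_all add: module_hom_zero[OF assms(1-3)])
qed

lemma module_hom_minus_eq_zero_iff:
  assumes "h \<in> module_hom k M N" "module k M" "module k N" "x \<in> carrier M" "y \<in> carrier M"
  shows "h (x \<ominus>\<^bsub>M\<^esub> y) = \<zero>\<^bsub>N\<^esub> \<longleftrightarrow> h x = h y"
proof -
  interpret M: module k M by fact
  interpret N: module k N by fact
  have "h (x \<ominus>\<^bsub>M\<^esub> y) \<oplus>\<^bsub>N\<^esub> h y = h (x \<ominus>\<^bsub>M\<^esub> y \<oplus>\<^bsub>M\<^esub> y)"
    using assms by (intro module_hom_add[symmetric]) auto
  also have "x \<ominus>\<^bsub>M\<^esub> y \<oplus>\<^bsub>M\<^esub> y = x"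
    using assms(4,5) by (simp add: M.minus_eq M.a_assoc M.l_neg)
  finally have *: "h (x \<ominus>\<^bsub>M\<^esub> y) \<oplus>\<^bsub>N\<^esub> h y = h x" .
  have "h (x \<ominus>\<^bsub>M\<^esub> y) \<in> carrier N" "h y \<in> carrier N"
    using assms by (auto intro: module_hom_closed)
  then show ?thesis using * by (metis N.l_zero N.add.r_cancel_one)
qed

lemma module_hom_sum:
  assumes "module k M" "module k N" "\<And>i. i \<in> I \<Longrightarrow> f i \<in> module_hom k M N" "finite I"
  shows "(\<lambda>x. \<Oplus>\<^bsub>N\<^esub>i\<in>I. f i x) \<in> module_hom k M N"
proof -
  interpret M: module k M by fact
  interpret N: module k N by fact
  note [simp] = module_hom_closed[OF assms(3)] module_hom_add[OF assms(3)] module_hom_smult[OF assms(3)]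
  show ?thesis
  proof (rule module_homI)
    fix x y assume [simp]: "x \<in> carrier M" "y \<in> carrier M"
    have "(\<Oplus>\<^bsub>N\<^esub>i\<in>I. f i (x \<oplus>\<^bsub>M\<^esub> y)) = (\<Oplus>\<^bsub>N\<^esub>i\<in>I. f i x \<oplus>\<^bsub>N\<^esub> f i y)"
      by (rule N.finsum_cong') (auto simp: Pi_def)
    also have "\<dots> = (\<Oplus>\<^bsub>N\<^esub>i\<in>I. f i x) \<oplus>\<^bsub>N\<^esub> (\<Oplus>\<^bsub>N\<^esub>i\<in>I. f i y)"
      by (rule N.finsum_addf) (auto simp: Pi_def)
    finally show "(\<Oplus>\<^bsub>N\<^esub>i\<in>I. f i (x \<oplus>\<^bsub>M\<^esub> y)) = \<dots>" .
  next
    fix c x assume [simp]: "c \<in> carrier k" "x \<in> carrier M"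
    have "(\<Oplus>\<^bsub>N\<^esub>i\<in>I. f i (c \<odot>\<^bsub>M\<^esub> x)) = (\<Oplus>\<^bsub>N\<^esub>i\<in>I. c \<odot>\<^bsub>N\<^esub> f i x)"
      by (rule N.finsum_cong') (auto simp: Pi_def)
    also have "\<dots> = c \<odot>\<^bsub>N\<^esub> (\<Oplus>\<^bsub>N\<^esub>i\<in>I. f i x)"
      by (rule N.finsum_smult_ldistr[symmetric]) (auto simp: Pi_def assms(4))
    finally show "(\<Oplus>\<^bsub>N\<^esub>i\<in>I. f i (c \<odot>\<^bsub>M\<^esub> x)) = \<dots>" .
  qed (auto simp: Pi_def)
qed

lemma finsum_swap:
  assumes "module k M" "finite I" "finite J" "\<And>i j. \<lbrakk>i \<in> I; j \<in> J\<rbrakk> \<Longrightarrow> f i j \<in> carrier M"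
  shows "(\<Oplus>\<^bsub>M\<^esub>i\<in>I. \<Oplus>\<^bsub>M\<^esub>j\<in>J. f i j) = (\<Oplus>\<^bsub>M\<^esub>j\<in>J. \<Oplus>\<^bsub>M\<^esub>i\<in>I. f i j)"
proof -
  interpret M: module k M by fact
  show ?thesis using assms(2,4)
  proof (induction I rule: finite_induct)
    case (insert x F)
    have "(\<Oplus>\<^bsub>M\<^esub>j\<in>J. \<Oplus>\<^bsub>M\<^esub>i\<in>insert x F. f i j) = (\<Oplus>\<^bsub>M\<^esub>j\<in>J. f x j \<oplus>\<^bsub>M\<^esub> (\<Oplus>\<^bsub>M\<^esub>i\<in>F. f i j))"
      using insert by (intro M.finsum_cong') (auto simp: Pi_def)
    then show ?case using insert by (simp add: Pi_def M.finsum_addf)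
  qed simp
qed

section \<open>Free modules and quotient modules\<close>

lemma free_module_simps:
  "carrier (free_module k S) = {f. range f \<subseteq> carrier k \<and> finite {s. f s \<noteq> \<zero>\<^bsub>k\<^esub>} \<and> {s. f s \<noteq> \<zero>\<^bsub>k\<^esub>} \<subseteq> S}"
  "\<zero>\<^bsub>free_module k S\<^esub> = (\<lambda>s. \<zero>\<^bsub>k\<^esub>)"
  "f \<oplus>\<^bsub>free_module k S\<^esub> g = (\<lambda>s. f s \<oplus>\<^bsub>k\<^esub> g s)"
  "c \<odot>\<^bsub>free_module k S\<^esub> f = (\<lambda>s. c \<otimes>\<^bsub>k\<^esub> f s)"
  by (auto simp: free_module_def)

lemma module_free_module:
  assumes "cring k" shows "module k (free_module k S)"
proof -
  interpret cring k by fact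
  let ?F = "free_module k S"
  have *: "f \<in> carrier ?F \<longleftrightarrow>
      (\<forall>s. f s \<in> carrier k) \<and> finite {s. f s \<noteq> \<zero>\<^bsub>k\<^esub>} \<and> (\<forall>s. f s \<noteq> \<zero>\<^bsub>k\<^esub> \<longrightarrow> s \<in> S)" for f
    by (auto simp: free_module_simps)
  have sub: "\<lbrakk>f \<in> carrier ?F; g \<in> carrier ?F\<rbrakk> \<Longrightarrow>
      finite {s. f s \<oplus>\<^bsub>k\<^esub> g s \<noteq> \<zero>\<^bsub>k\<^esub>}" for f g
    by (rule finite_subset[of _ "{s. f s \<noteq> \<zero>\<^bsub>k\<^esub>} \<union> {s. g s \<noteq> \<zero>\<^bsub>k\<^esub>}"]) (auto simp: *)
  have add: "\<lbrakk>f \<in> carrier ?F; g \<in> carrier ?F\<rbrakk> \<Longrightarrow> f \<oplus>\<^bsub>?F\<^esub> g \<in> carrier ?F" for f g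
    using sub[of f g] by (auto simp: free_module_simps range_subsetD subset_iff) (metis r_zero zero_closed)
  have smult: "c \<odot>\<^bsub>?F\<^esub> f \<in> carrier ?F" if "c \<in> carrier k" "f \<in> carrier ?F" for c f
  proof -
    have "finite {s. c \<otimes>\<^bsub>k\<^esub> f s \<noteq> \<zero>\<^bsub>k\<^esub>}"
      by (rule finite_subset[of _ "{s. f s \<noteq> \<zero>\<^bsub>k\<^esub>}"]) (use that in \<open>auto simp: *\<close>)
    with that show ?thesis by (auto simp: free_module_simps range_subsetD)
  qed
  show ?thesis
  proof (rule moduleI)
    show "abelian_group ?F"
    proof (rule abelian_groupI)
      fix f assume f: "f \<in> carrier ?F"
      have "(\<lambda>s. \<ominus>\<^bsub>k\<^esub> f s) \<oplus>\<^bsub>?F\<^esub> f = \<zero>\<^bsub>?F\<^esub>" using f by (auto simp: free_module_simps range_subsetD l_neg)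
      moreover have "(\<ominus>\<^bsub>k\<^esub> \<one>\<^bsub>k\<^esub>) \<odot>\<^bsub>?F\<^esub> f = (\<lambda>s. \<ominus>\<^bsub>k\<^esub> f s)"
        using f by (auto simp: free_module_simps range_subsetD l_minus)
      ultimately show "\<exists>g\<in>carrier ?F. g \<oplus>\<^bsub>?F\<^esub> f = \<zero>\<^bsub>?F\<^esub>" using smult[OF _ f]
        by (metis a_inv_closed one_closed)
    next
      fix f g h assume "f \<in> carrier ?F" "g \<in> carrier ?F" "h \<in> carrier ?F"
      then show "f \<oplus>\<^bsub>?F\<^esub> g \<oplus>\<^bsub>?F\<^esub> h = f \<oplus>\<^bsub>?F\<^esub> (g \<oplus>\<^bsub>?F\<^esub> h)"
        by (auto simp: free_module_simps range_subsetD a_assoc)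
    qed (use add in \<open>auto simp: free_module_simps range_subsetD a_comm\<close>)
  qed (use assms smult in \<open>auto simp: free_module_simps range_subsetD l_distr r_distr m_assoc\<close>)
qed

lemma free_gen_closed: "\<lbrakk>cring k; s \<in> S\<rbrakk> \<Longrightarrow> free_gen k s \<in> carrier (free_module k S)"
  by (auto simp: free_module_simps free_gen_def cring_def
      intro: ring.ring_simprules finite_subset[of _ "{s}"])

text \<open>
  Induction on a finite set that contains the support: clearing one coefficient of \<open>c\<close> splits off a
  multiple of a generator.
\<close>

lemma free_module_induct [consumes 2, case_names zero add gen]:
  assumes k: "cring k" and c: "c \<in> carrier (free_module k S)"
    and zero: "P \<zero>\<^bsub>free_module k S\<^esub>"
    and add: "\<And>c d. \<lbrakk>c \<in> carrier (free_module k S); d \<in> carrier (free_module k S); P c; P d\<rbrakk> \<Longrightarrow>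
        P (c \<oplus>\<^bsub>free_module k S\<^esub> d)"
    and gen: "\<And>a s. \<lbrakk>a \<in> carrier k; s \<in> S\<rbrakk> \<Longrightarrow> P (a \<odot>\<^bsub>free_module k S\<^esub> free_gen k s)"
  shows "P c"
proof -
  interpret cring k by fact
  interpret F: module k "free_module k S" by (rule module_free_module) fact
  have fin: "finite {s. c s \<noteq> \<zero>\<^bsub>k\<^esub>}" using c by (simp add: free_module_simps)
  have *: "finite I \<Longrightarrow> c \<in> carrier (free_module k S) \<Longrightarrow> {s. c s \<noteq> \<zero>\<^bsub>k\<^esub>} \<subseteq> I \<Longrightarrow> P c" for I c
  proof (induction I arbitrary: c rule: finite_induct)
    case empty
    then have "c = \<zero>\<^bsub>free_module k S\<^esub>" by (auto simp: free_module_simps)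
    then show ?case using zero by simp
  next
    case (insert x I)
    have c: "c s \<in> carrier k" for s using insert.prems by (auto simp: free_module_simps)
    let ?c = "c(x := \<zero>\<^bsub>k\<^esub>)"
    have 1: "?c \<in> carrier (free_module k S)"
      using insert.prems by (auto simp: free_module_simps intro: finite_subset[OF _ \<open>finite I\<close>])
    have "P ?c" using insert.prems by (intro insert.IH 1) auto
    show ?case
    proof (cases "x \<in> S")
      case True
      have eq: "c = ?c \<oplus>\<^bsub>free_module k S\<^esub> (c x \<odot>\<^bsub>free_module k S\<^esub> free_gen k x)"
        using c by (auto simp: free_module_simps free_gen_def fun_eq_iff)
      have "P (?c \<oplus>\<^bsub>free_module k S\<^esub> (c x \<odot>\<^bsub>free_module k S\<^esub> free_gen k x))"
        using True c free_gen_closed[OF k] by (intro add 1 \<open>P ?c\<close> gen F.smult_closed) auto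
      then show ?thesis by (rule iffD2[OF arg_cong[where f = P, OF eq]])
    next
      case False
      then have "c x = \<zero>\<^bsub>k\<^esub>" using insert.prems by (auto simp: free_module_simps)
      then have "?c = c" by (rule fun_upd_idem)
      then show ?thesis using \<open>P ?c\<close> by simp
    qed
  qed
  show ?thesis by (rule *[OF fin c order_refl])
qed

text \<open>
  For a coefficient function \<open>c\<close> on tuples this is the sum in the definition of \<^const>\<open>tensor_lift\<close>.
\<close>

definition linear_extension ::
  "('k, 'x) ring_scheme \<Rightarrow> ('k, 't, 'y) module_scheme \<Rightarrow> ('s \<Rightarrow> 't) \<Rightarrow> ('s \<Rightarrow> 'k) \<Rightarrow> 't"
  where "linear_extension k T f c = (\<Oplus>\<^bsub>T\<^esub>s\<in>{s. c s \<noteq> \<zero>\<^bsub>k\<^esub>}. c s \<odot>\<^bsub>T\<^esub> f s)"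

text \<open>
  Two coefficient functions have different supports; over a common finite superset of the supports
  the sums can be added term by term.
\<close>

lemma linear_extension_superset:
  assumes "module k T" "f \<in> S \<rightarrow> carrier T" "c \<in> carrier (free_module k S)"
    and "finite I" "{s. c s \<noteq> \<zero>\<^bsub>k\<^esub>} \<subseteq> I" "I \<subseteq> S"
  shows "linear_extension k T f c = (\<Oplus>\<^bsub>T\<^esub>s\<in>I. c s \<odot>\<^bsub>T\<^esub> f s)"
proof -
  interpret T: module k T by fact
  have c: "c s \<in> carrier k" for s using assms(3) by (auto simp: free_module_simps)
  show ?thesis unfolding linear_extension_def
  proof (rule T.add.finprod_mono_neutral_cong_left)
    show "c s \<odot>\<^bsub>T\<^esub> f s = \<zero>\<^bsub>T\<^esub>" if "s \<in> I - {s. c s \<noteq> \<zero>\<^bsub>k\<^esub>}" for s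
      using that assms(2,6) by (auto intro!: T.smult_l_null)
    show "(\<lambda>s. c s \<odot>\<^bsub>T\<^esub> f s) \<in> I \<rightarrow> carrier T"
      using assms(2,6) c by auto
  qed (use assms(4,5) in auto)
qed

lemma linear_extension_hom:
  assumes "module k T" "f \<in> S \<rightarrow> carrier T"
  shows "linear_extension k T f \<in> module_hom k (free_module k S) T"
proof -
  interpret T: module k T by fact
  interpret F: module k "free_module k S" by (rule module_free_module) (rule T.is_cring)
  note sup = linear_extension_superset[OF assms]
  have f: "f s \<in> carrier T" if "s \<in> S" for s using assms(2) that by blast
  have c: "c s \<in> carrier k" if "c \<in> carrier (free_module k S)" for c s
    using that by (auto simp: free_module_simps)
  show ?thesis
  proof (rule module_homI)
    fix c assume "c \<in> carrier (free_module k S)"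
    then show "linear_extension k T f c \<in> carrier T"
      unfolding linear_extension_def
      by (intro T.finsum_closed) (auto simp: free_module_simps f range_subsetD)
  next
    fix c d assume cd: "c \<in> carrier (free_module k S)" "d \<in> carrier (free_module k S)"
    let ?I = "{s. c s \<noteq> \<zero>\<^bsub>k\<^esub>} \<union> {s. d s \<noteq> \<zero>\<^bsub>k\<^esub>}"
    have I: "finite ?I" "?I \<subseteq> S" using cd by (auto simp: free_module_simps)
    have 1: "linear_extension k T f (c \<oplus>\<^bsub>free_module k S\<^esub> d) =
        (\<Oplus>\<^bsub>T\<^esub>s\<in>?I. (c \<oplus>\<^bsub>free_module k S\<^esub> d) s \<odot>\<^bsub>T\<^esub> f s)"
      using cd I by (intro sup F.a_closed) (auto simp: free_module_simps)
    have 2: "\<dots> = (\<Oplus>\<^bsub>T\<^esub>s\<in>?I. c s \<odot>\<^bsub>T\<^esub> f s \<oplus>\<^bsub>T\<^esub> d s \<odot>\<^bsub>T\<^esub> f s)"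
      using cd I by (intro T.finsum_cong')
        (auto simp: free_module_simps(3) c f T.smult_l_distr subset_iff)
    have 3: "\<dots> = (\<Oplus>\<^bsub>T\<^esub>s\<in>?I. c s \<odot>\<^bsub>T\<^esub> f s) \<oplus>\<^bsub>T\<^esub> (\<Oplus>\<^bsub>T\<^esub>s\<in>?I. d s \<odot>\<^bsub>T\<^esub> f s)"
      using cd I by (intro T.finsum_addf) (auto simp: c f subset_iff)
    show "linear_extension k T f (c \<oplus>\<^bsub>free_module k S\<^esub> d) =
        linear_extension k T f c \<oplus>\<^bsub>T\<^esub> linear_extension k T f d"
      using trans[OF 1 trans[OF 2 3]] sup[OF cd(1) I(1) _ I(2)] sup[OF cd(2) I(1) _ I(2)]
      by simp
  next
    fix a c assume ac: "a \<in> carrier k" "c \<in> carrier (free_module k S)"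
    let ?I = "{s. c s \<noteq> \<zero>\<^bsub>k\<^esub>}"
    have I: "finite ?I" "?I \<subseteq> S" using ac by (auto simp: free_module_simps)
    have 1: "linear_extension k T f (a \<odot>\<^bsub>free_module k S\<^esub> c) =
        (\<Oplus>\<^bsub>T\<^esub>s\<in>?I. (a \<odot>\<^bsub>free_module k S\<^esub> c) s \<odot>\<^bsub>T\<^esub> f s)"
      using ac I by (intro sup F.smult_closed) (auto simp: free_module_simps)
    have 2: "\<dots> = (\<Oplus>\<^bsub>T\<^esub>s\<in>?I. a \<odot>\<^bsub>T\<^esub> (c s \<odot>\<^bsub>T\<^esub> f s))"
      using ac I by (intro T.finsum_cong')
        (auto simp: free_module_simps(4) c f T.smult_assoc1 subset_iff)
    have 3: "\<dots> = a \<odot>\<^bsub>T\<^esub> (\<Oplus>\<^bsub>T\<^esub>s\<in>?I. c s \<odot>\<^bsub>T\<^esub> f s)"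
      using ac I by (intro T.finsum_smult_ldistr[symmetric]) (auto simp: c f subset_iff)
    show "linear_extension k T f (a \<odot>\<^bsub>free_module k S\<^esub> c) = a \<odot>\<^bsub>T\<^esub> linear_extension k T f c"
      using trans[OF 1 trans[OF 2 3]] by (simp only: linear_extension_def[of k T f c])
  qed
qed

lemma linear_extension_free_gen:
  assumes "module k T" "f \<in> S \<rightarrow> carrier T" "s \<in> S"
  shows "linear_extension k T f (free_gen k s) = f s"
proof -
  interpret T: module k T by fact
  have fs: "f s \<in> carrier T" using assms by blast
  have "linear_extension k T f (free_gen k s) = (\<Oplus>\<^bsub>T\<^esub>t\<in>{s}. free_gen k s t \<odot>\<^bsub>T\<^esub> f t)"
    using assms free_gen_closed[OF T.is_cring]
    by (intro linear_extension_superset) (auto simp: free_gen_def)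
  then show ?thesis using fs by (simp add: free_gen_def)
qed

lemma submodule_carrier:
  assumes "module k M" shows "submodule (carrier M) k M"
proof -
  interpret module k M by fact
  show ?thesis by (rule submoduleI) auto
qed

lemma submodule_vimage_zero:
  assumes "module k M" "module k N" "h \<in> module_hom k M N"
  shows "submodule {x \<in> carrier M. h x = \<zero>\<^bsub>N\<^esub>} k M"
proof -
  interpret M: module k M by fact
  interpret N: module k N by fact
  note [simp] = module_hom_closed[OF assms(3)] module_hom_add[OF assms(3)] module_hom_smult[OF assms(3)]
  show ?thesis
  proof (rule M.submoduleI)
    fix a assume "a \<in> {x \<in> carrier M. h x = \<zero>\<^bsub>N\<^esub>}"
    then show "\<ominus>\<^bsub>M\<^esub> a \<in> {x \<in> carrier M. h x = \<zero>\<^bsub>N\<^esub>}"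
      using module_hom_zero[OF assms(3,1,2)] module_hom_add[OF assms(3), of a "\<ominus>\<^bsub>M\<^esub> a"]
      by (auto simp: M.r_neg)
  qed (auto simp: module_hom_zero[OF assms(3,1,2)])
qed

lemma submodule_span_submodule:
  assumes "module k M" "X \<subseteq> carrier M"
  shows "submodule (submodule_span k M X) k M"
proof -
  interpret M: module k M by fact
  have ne: "carrier M \<in> {N. submodule N k M \<and> X \<subseteq> N}"
    using submodule_carrier[OF assms(1)] assms(2) by simp
  show ?thesis unfolding submodule_span_def
  proof (rule M.submoduleI)
    show "\<Inter>{N. submodule N k M \<and> X \<subseteq> N} \<subseteq> carrier M" using ne by blast
  next
    show "\<zero>\<^bsub>M\<^esub> \<in> \<Inter>{N. submodule N k M \<and> X \<subseteq> N}"
      using submodule.axioms(1)[THEN subgroup.one_closed] by fastforce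
  qed (use M.submoduleE(3-5) in blast)+
qed

lemma submodule_span_superset: "X \<subseteq> submodule_span k M X"
  by (auto simp: submodule_span_def)

lemma submodule_span_minimal: "\<lbrakk>submodule N k M; X \<subseteq> N\<rbrakk> \<Longrightarrow> submodule_span k M X \<subseteq> N"
  by (auto simp: submodule_span_def)

locale quotient = module k M for k :: "('k, 'x) ring_scheme" and M :: "('k, 'm, 'y) module_scheme" +
  fixes N assumes sub: "submodule N k M"
begin

lemma N_subset: "N \<subseteq> carrier M" using submoduleE(1)[OF sub] .

lemma N_subgroup: "subgroup N (add_monoid M)" using sub by (simp add: submodule_def)

sublocale abelian_subgroup N M
  by (rule abelian_subgroupI3)
    (use N_subgroup in \<open>auto simp: additive_subgroup_def intro: M.abelian_group_axioms\<close>)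

abbreviation "Q \<equiv> quotient_module M N"

lemma quotient_carrierE:
  assumes "X \<in> carrier Q" obtains c where "c \<in> carrier M" "X = N +>\<^bsub>M\<^esub> c"
  using assms by (auto simp: quotient_module_def A_RCOSETS_def')

lemma coset_closed: "c \<in> carrier M \<Longrightarrow> N +>\<^bsub>M\<^esub> c \<in> carrier Q"
  by (auto simp: quotient_module_def A_RCOSETS_def')

lemma coset_eqI:
  assumes "c \<in> carrier M" "x \<in> N +>\<^bsub>M\<^esub> c" shows "N +>\<^bsub>M\<^esub> x = N +>\<^bsub>M\<^esub> c"
  using M.a_repr_independence[OF assms(2,1) N_subgroup] by simp

lemma coset_memE:
  assumes "x \<in> N +>\<^bsub>M\<^esub> c" obtains n where "n \<in> N" "x = n \<oplus>\<^bsub>M\<^esub> c"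
  using assms by (auto simp: a_r_coset_def')

text \<open>
  The union in the definition of the scalar multiplication is a union of equal cosets.
\<close>

lemma coset_smult:
  assumes "a \<in> carrier k" "c \<in> carrier M"
  shows "a \<odot>\<^bsub>Q\<^esub> (N +>\<^bsub>M\<^esub> c) = N +>\<^bsub>M\<^esub> (a \<odot>\<^bsub>M\<^esub> c)"
proof -
  have "N +>\<^bsub>M\<^esub> (a \<odot>\<^bsub>M\<^esub> x) = N +>\<^bsub>M\<^esub> (a \<odot>\<^bsub>M\<^esub> c)" if "x \<in> N +>\<^bsub>M\<^esub> c" for x
  proof -
    obtain n where n: "n \<in> N" "x = n \<oplus>\<^bsub>M\<^esub> c" using \<open>x \<in> N +>\<^bsub>M\<^esub> c\<close> by (rule coset_memE)
    then have "a \<odot>\<^bsub>M\<^esub> x = a \<odot>\<^bsub>M\<^esub> n \<oplus>\<^bsub>M\<^esub> a \<odot>\<^bsub>M\<^esub> c"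
      using assms N_subset by (auto simp: smult_r_distr)
    then have "a \<odot>\<^bsub>M\<^esub> x \<in> N +>\<^bsub>M\<^esub> (a \<odot>\<^bsub>M\<^esub> c)"
      using n assms submodule.smult_closed[OF sub] by (auto simp: a_r_coset_def')
    then show ?thesis using assms by (intro coset_eqI) auto
  qed
  moreover have "c \<in> N +>\<^bsub>M\<^esub> c" using a_rcos_self assms by blast
  ultimately have "(\<Union>x\<in>N +>\<^bsub>M\<^esub> c. N +>\<^bsub>M\<^esub> (a \<odot>\<^bsub>M\<^esub> x)) = N +>\<^bsub>M\<^esub> (a \<odot>\<^bsub>M\<^esub> c)"
    by (intro SUP_eq_const) blast+
  then show ?thesis by (simp only: quotient_module_def module.select_convs)
qed

lemma coset_add:
  assumes "c \<in> carrier M" "d \<in> carrier M"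
  shows "(N +>\<^bsub>M\<^esub> c) \<oplus>\<^bsub>Q\<^esub> (N +>\<^bsub>M\<^esub> d) = N +>\<^bsub>M\<^esub> (c \<oplus>\<^bsub>M\<^esub> d)"
  using a_rcos_sum[OF assms] by (simp add: quotient_module_def)

lemma coset_zero: "\<zero>\<^bsub>Q\<^esub> = N +>\<^bsub>M\<^esub> \<zero>\<^bsub>M\<^esub>"
  using N_subset by (simp add: quotient_module_def)

lemma module_quotient: "module k Q"
proof (rule moduleI)
  show "abelian_group Q"
  proof (rule abelian_groupI)
    fix X assume "X \<in> carrier Q"
    then obtain c where c: "c \<in> carrier M" "X = N +>\<^bsub>M\<^esub> c" by (rule quotient_carrierE)
    then show "\<exists>Y\<in>carrier Q. Y \<oplus>\<^bsub>Q\<^esub> X = \<zero>\<^bsub>Q\<^esub>"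
      by (intro bexI[of _ "N +>\<^bsub>M\<^esub> (\<ominus>\<^bsub>M\<^esub> c)"]) (auto simp: coset_add coset_zero coset_closed M.l_neg)
  next
    fix X Y Z assume "X \<in> carrier Q" "Y \<in> carrier Q" "Z \<in> carrier Q"
    then show "X \<oplus>\<^bsub>Q\<^esub> Y \<oplus>\<^bsub>Q\<^esub> Z = X \<oplus>\<^bsub>Q\<^esub> (Y \<oplus>\<^bsub>Q\<^esub> Z)"
      by (elim quotient_carrierE) (simp add: coset_add M.a_assoc)
  next
    fix X Y assume "X \<in> carrier Q" "Y \<in> carrier Q"
    then show "X \<oplus>\<^bsub>Q\<^esub> Y = Y \<oplus>\<^bsub>Q\<^esub> X"
      by (elim quotient_carrierE) (simp add: coset_add M.a_comm)
  qed (auto elim!: quotient_carrierE simp: coset_add coset_zero coset_closed)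
qed (auto elim!: quotient_carrierE
    simp: coset_add coset_smult coset_closed smult_l_distr smult_r_distr smult_assoc1
    intro: is_cring)

lemma coset_hom: "(\<lambda>c. N +>\<^bsub>M\<^esub> c) \<in> module_hom k M Q"
  by (rule module_homI) (auto simp: coset_closed coset_add coset_smult)

lemma coset_of_mem: "n \<in> N \<Longrightarrow> N +>\<^bsub>M\<^esub> n = \<zero>\<^bsub>Q\<^esub>"
  using M.a_coset_join2[OF _ N_subgroup] N_subset by (auto simp: quotient_module_def)

end

section \<open>The universal property of tensor powers\<close>

text \<open>
  Updating one position of a tuple is how \<^const>\<open>multilinear_rels\<close> speaks of linearity in that
  position, and this matches it. Membership of all values in the target is listed separately because
  for \<open>n = 0\<close> there is no position from which it would follow.
\<close>

definition multilinear ::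
  "('k, 'x) ring_scheme \<Rightarrow> ('k, 'm, 'y) module_scheme \<Rightarrow> ('k, 't, 'z) module_scheme \<Rightarrow> nat \<Rightarrow>
    ('m list \<Rightarrow> 't) \<Rightarrow> bool"
  where "multilinear k M T n f \<longleftrightarrow> f \<in> tuples M n \<rightarrow> carrier T \<and>
    (\<forall>xs\<in>tuples M n. \<forall>i<n. (\<lambda>x. f (xs[i := x])) \<in> module_hom k M T)"

lemma tuples_update: "\<lbrakk>xs \<in> tuples M n; x \<in> carrier M\<rbrakk> \<Longrightarrow> xs[i := x] \<in> tuples M n"
  using set_update_subset_insert[of xs i x] by (auto simp: tuples_def)

lemma tuples_nth: "\<lbrakk>xs \<in> tuples M n; i < n\<rbrakk> \<Longrightarrow> xs ! i \<in> carrier M"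
  by (auto simp: tuples_def)

lemma tuples2_eq: "xs \<in> tuples M 2 \<Longrightarrow> xs = [xs ! 0, xs ! 1]"
  by (auto simp: tuples_def numeral_2_eq_2 length_Suc_conv)

lemma tuples3_eq: "xs \<in> tuples M 3 \<Longrightarrow> xs = [xs ! 0, xs ! 1, xs ! 2]"
  by (auto simp: tuples_def numeral_3_eq_3 numeral_2_eq_2 length_Suc_conv)

lemma map2_tuples3:
  assumes "xs \<in> tuples M 3" "ys \<in> tuples M 3"
  shows "map2 f xs ys = [f (xs ! 0) (ys ! 0), f (xs ! 1) (ys ! 1), f (xs ! 2) (ys ! 2)]"
  using assms by (auto simp: tuples_def numeral_3_eq_3 numeral_2_eq_2 length_Suc_conv)

lemma multilinear_cong:
  assumes "multilinear k M T n f" "module k M" "\<And>xs. xs \<in> tuples M n \<Longrightarrow> f xs = g xs"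
  shows "multilinear k M T n g"
proof -
  have "(\<lambda>x. g (xs[i := x])) \<in> module_hom k M T" if "xs \<in> tuples M n" "i < n" for xs i
  proof (rule module_hom_cong[OF _ assms(2)])
    show "(\<lambda>x. f (xs[i := x])) \<in> module_hom k M T" using assms(1) that by (simp add: multilinear_def)
    show "f (xs[i := x]) = g (xs[i := x])" if "x \<in> carrier M" for x
      using \<open>xs \<in> tuples M n\<close> that by (intro assms(3) tuples_update)
  qed
  moreover have "g \<in> tuples M n \<rightarrow> carrier T"
    using assms(1) funcset_mem[of f "tuples M n" "carrier T"] assms(3)
    by (intro funcsetI) (simp add: multilinear_def)
  ultimately show ?thesis by (simp add: multilinear_def)
qed

lemma multilinear_rels_subset:
  assumes "module k M"
  shows "multilinear_rels k M n \<subseteq> carrier (free_module k (tuples M n))"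
proof -
  interpret M: module k M by fact
  interpret F: module k "free_module k (tuples M n)" by (rule module_free_module) (rule M.is_cring)
  show ?thesis
    unfolding multilinear_rels_def Let_def
    by (auto intro!: F.minus_closed F.a_closed F.smult_closed free_gen_closed M.is_cring tuples_update)
qed

lemma quotient_tensor_kernel:
  assumes "module k M"
  shows "quotient k (free_module k (tuples M n)) (tensor_kernel k M n)"
proof -
  interpret M: module k M by fact
  interpret F: module k "free_module k (tuples M n)" by (rule module_free_module) (rule M.is_cring)
  show ?thesis
    unfolding tensor_kernel_def
    by (intro quotient.intro quotient_axioms.intro F.module_axioms
      submodule_span_submodule[OF F.module_axioms multilinear_rels_subset[OF assms]])
qed

lemma module_tensor_power: "module k M \<Longrightarrow> module k (tensor_power k M n)"
  unfolding tensor_power_def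
  by (rule quotient.module_quotient[OF quotient_tensor_kernel])

lemma tensor_eq_coset:
  "xs \<in> tuples M n \<Longrightarrow>
    tensor k M xs = tensor_kernel k M n +>\<^bsub>free_module k (tuples M n)\<^esub> free_gen k xs"
  by (auto simp: tensor_def tuples_def)

text \<open>
  The defining relations lie in the kernel of the projection onto the tensor power.
\<close>

lemma tensor_multilinear:
  assumes "module k M"
  shows "multilinear k M (tensor_power k M n) n (tensor k M)"
proof -
  interpret M: module k M by fact
  let ?F = "free_module k (tuples M n)" and ?N = "tensor_kernel k M n"
  interpret quotient k ?F ?N by (rule quotient_tensor_kernel) fact
  let ?q = "\<lambda>c. ?N +>\<^bsub>?F\<^esub> c"
  note T = module_tensor_power[OF assms, of n]
  interpret T: module k "tensor_power k M n" by (rule T)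
  have q: "?q \<in> module_hom k ?F (tensor_power k M n)"
    using coset_hom by (simp add: tensor_power_def)
  have qeq: "?q c = ?q d" if "c \<ominus>\<^bsub>?F\<^esub> d \<in> multilinear_rels k M n"
    "c \<in> carrier ?F" "d \<in> carrier ?F" for c d
  proof -
    have "c \<ominus>\<^bsub>?F\<^esub> d \<in> ?N" unfolding tensor_kernel_def
      using that(1) by (rule subsetD[OF submodule_span_superset])
    then have "?q (c \<ominus>\<^bsub>?F\<^esub> d) = \<zero>\<^bsub>tensor_power k M n\<^esub>"
      using coset_of_mem by (simp only: tensor_power_def)
    then show ?thesis
      using module_hom_minus_eq_zero_iff[OF q module_axioms T that(2,3)] by blast
  qed
  note gen = free_gen_closed[OF M.is_cring, of _ "tuples M n"]
  show ?thesis
    unfolding multilinear_def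
  proof (intro conjI ballI allI impI)
    show "tensor k M \<in> tuples M n \<rightarrow> carrier (tensor_power k M n)"
      using gen module_hom_closed[OF q] by (auto simp: tensor_eq_coset)
    fix xs i assume xs: "xs \<in> tuples M n" and i: "i < n"
    show "(\<lambda>x. tensor k M (xs[i := x])) \<in> module_hom k M (tensor_power k M n)"
    proof (rule module_homI)
      fix x y assume xy: "x \<in> carrier M" "y \<in> carrier M"
      then have mem: "xs[i := x] \<in> tuples M n" "xs[i := y] \<in> tuples M n" "xs[i := x \<oplus>\<^bsub>M\<^esub> y] \<in> tuples M n"
        using xs by (auto intro: tuples_update)
      have "?q (free_gen k (xs[i := x \<oplus>\<^bsub>M\<^esub> y])) =
          ?q (free_gen k (xs[i := x]) \<oplus>\<^bsub>?F\<^esub> free_gen k (xs[i := y]))"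
        using mem xs i xy
        by (intro qeq M.a_closed gen) (auto simp: multilinear_rels_def Let_def intro!: gen)
      then show "tensor k M (xs[i := x \<oplus>\<^bsub>M\<^esub> y]) =
          tensor k M (xs[i := x]) \<oplus>\<^bsub>tensor_power k M n\<^esub> tensor k M (xs[i := y])"
        using mem gen by (simp add: tensor_eq_coset module_hom_add[OF q])
    next
      fix c x assume cx: "c \<in> carrier k" "x \<in> carrier M"
      then have mem: "xs[i := x] \<in> tuples M n" "xs[i := c \<odot>\<^bsub>M\<^esub> x] \<in> tuples M n"
        using xs by (auto intro: tuples_update)
      have "?q (free_gen k (xs[i := c \<odot>\<^bsub>M\<^esub> x])) = ?q (c \<odot>\<^bsub>?F\<^esub> free_gen k (xs[i := x]))"
        using mem xs i cx
        by (intro qeq smult_closed gen) (auto simp: multilinear_rels_def Let_def intro!: gen)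
      then show "tensor k M (xs[i := c \<odot>\<^bsub>M\<^esub> x]) = c \<odot>\<^bsub>tensor_power k M n\<^esub> tensor k M (xs[i := x])"
        using mem gen cx by (simp add: tensor_eq_coset module_hom_smult[OF q])
    next
      fix x assume "x \<in> carrier M"
      then have "xs[i := x] \<in> tuples M n" using xs by (intro tuples_update)
      then show "tensor k M (xs[i := x]) \<in> carrier (tensor_power k M n)"
        by (simp add: tensor_eq_coset gen module_hom_closed[OF q])
    qed
  qed
qed

lemma tensor_closed:
  "\<lbrakk>module k M; xs \<in> tuples M n\<rbrakk> \<Longrightarrow> tensor k M xs \<in> carrier (tensor_power k M n)"
  using tensor_multilinear[of k M n] by (auto simp: multilinear_def)

lemma tensor_power_carrierE:
  assumes "module k M" "X \<in> carrier (tensor_power k M n)"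
  obtains c where "c \<in> carrier (free_module k (tuples M n))"
    "X = tensor_kernel k M n +>\<^bsub>free_module k (tuples M n)\<^esub> c"
  using quotient.quotient_carrierE[OF quotient_tensor_kernel[OF assms(1), of n]] assms(2)
  unfolding tensor_power_def by metis

text \<open>
  The linear extension of a multilinear map annihilates the defining relations, hence the submodule
  that they span; therefore it takes a single value on each coset and \<^const>\<open>the_elem\<close> returns it.
\<close>

lemma tensor_lift_coset:
  assumes M: "module k M" and T: "module k T" and f: "multilinear k M T n f"
    and c: "c \<in> carrier (free_module k (tuples M n))"
  shows "tensor_lift k T f (tensor_kernel k M n +>\<^bsub>free_module k (tuples M n)\<^esub> c) =
    linear_extension k T f c"
proof -
  interpret M: module k M by fact
  interpret T: module k T by fact
  let ?F = "free_module k (tuples M n)" and ?N = "tensor_kernel k M n"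
  interpret quotient k ?F ?N by (rule quotient_tensor_kernel) fact
  have fT: "f \<in> tuples M n \<rightarrow> carrier T" using f by (simp add: multilinear_def)
  note L = linear_extension_hom[OF T fT]
  note gen = free_gen_closed[OF M.is_cring, of _ "tuples M n"]
  note Lgen = linear_extension_free_gen[OF T fT]
  have zero: "linear_extension k T f (c \<ominus>\<^bsub>?F\<^esub> d) = \<zero>\<^bsub>T\<^esub>"
    if "linear_extension k T f c = linear_extension k T f d"
    "c \<in> carrier ?F" "d \<in> carrier ?F" for c d
    using that module_hom_minus_eq_zero_iff[OF L module_axioms T] by blast
  have "multilinear_rels k M n \<subseteq> {c \<in> carrier ?F. linear_extension k T f c = \<zero>\<^bsub>T\<^esub>}"
  proof
    fix c assume c: "c \<in> multilinear_rels k M n"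
    then have "linear_extension k T f c = \<zero>\<^bsub>T\<^esub>"
      unfolding multilinear_rels_def Let_def
    proof (elim UnE CollectE exE conjE)
      fix xs i x y
      assume c: "c = free_gen k (xs[i := x \<oplus>\<^bsub>M\<^esub> y]) \<ominus>\<^bsub>?F\<^esub>
          (free_gen k (xs[i := x]) \<oplus>\<^bsub>?F\<^esub> free_gen k (xs[i := y]))"
        and *: "xs \<in> tuples M n" "i < n" "x \<in> carrier M" "y \<in> carrier M"
      have fi: "(\<lambda>x. f (xs[i := x])) \<in> module_hom k M T" using f * by (simp add: multilinear_def)
      show ?thesis unfolding c
        by (rule zero) (use * in \<open>auto simp: module_hom_add[OF L] gen tuples_update Lgen
              module_hom_add[OF fi] intro!: M.a_closed\<close>)
    next
      fix xs i a x
      assume c: "c = free_gen k (xs[i := a \<odot>\<^bsub>M\<^esub> x]) \<ominus>\<^bsub>?F\<^esub> (a \<odot>\<^bsub>?F\<^esub> free_gen k (xs[i := x]))"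
        and *: "xs \<in> tuples M n" "i < n" "a \<in> carrier k" "x \<in> carrier M"
      have fi: "(\<lambda>x. f (xs[i := x])) \<in> module_hom k M T" using f * by (simp add: multilinear_def)
      show ?thesis unfolding c
        by (rule zero) (use * in \<open>auto simp: module_hom_smult[OF L] gen tuples_update Lgen
              module_hom_smult[OF fi]\<close>)
    qed
    then show "c \<in> {c \<in> carrier ?F. linear_extension k T f c = \<zero>\<^bsub>T\<^esub>}"
      using c multilinear_rels_subset[OF M] by blast
  qed
  then have kernel: "?N \<subseteq> {c \<in> carrier ?F. linear_extension k T f c = \<zero>\<^bsub>T\<^esub>}"
    unfolding tensor_kernel_def
    by (intro submodule_span_minimal submodule_vimage_zero[OF module_axioms T L])
  have "linear_extension k T f x = linear_extension k T f c" if x: "x \<in> ?N +>\<^bsub>?F\<^esub> c" for x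
  proof -
    obtain m where m: "m \<in> ?N" "x = m \<oplus>\<^bsub>?F\<^esub> c" using x by (rule coset_memE)
    then have "linear_extension k T f x = linear_extension k T f m \<oplus>\<^bsub>T\<^esub> linear_extension k T f c"
      using kernel c by (auto simp: module_hom_add[OF L])
    then show ?thesis using kernel m(1) module_hom_closed[OF L c] by auto
  qed
  moreover have "c \<in> ?N +>\<^bsub>?F\<^esub> c" using a_rcos_self c by blast
  ultimately have "linear_extension k T f ` (?N +>\<^bsub>?F\<^esub> c) = {linear_extension k T f c}"
    by blast
  then show ?thesis unfolding tensor_lift_def linear_extension_def by simp
qed

lemma tensor_lift_hom:
  assumes "module k M" "module k T" "multilinear k M T n f"
  shows "tensor_lift k T f \<in> module_hom k (tensor_power k M n) T"
proof -
  interpret quotient k "free_module k (tuples M n)" "tensor_kernel k M n"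
    by (rule quotient_tensor_kernel) fact
  have L: "linear_extension k T f \<in> module_hom k (free_module k (tuples M n)) T"
    using assms by (intro linear_extension_hom) (simp_all add: multilinear_def)
  note lift = tensor_lift_coset[OF assms]
  show ?thesis
    unfolding tensor_power_def
    by (rule module_homI; elim quotient_carrierE)
      (simp_all add: coset_add coset_smult lift module_hom_closed[OF L] module_hom_add[OF L]
        module_hom_smult[OF L])
qed

lemma tensor_lift_tensor:
  assumes "module k M" "module k T" "multilinear k M T n f" "xs \<in> tuples M n"
  shows "tensor_lift k T f (tensor k M xs) = f xs"
proof -
  interpret M: module k M by fact
  have "tensor_lift k T f (tensor k M xs) = linear_extension k T f (free_gen k xs)"
    unfolding tensor_eq_coset[OF assms(4)]
    by (intro tensor_lift_coset assms free_gen_closed M.is_cring)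
  also have "\<dots> = f xs"
    using assms by (intro linear_extension_free_gen) (auto simp: multilinear_def)
  finally show ?thesis .
qed

text \<open>
  The generators of the free module are mapped to the pure tensors.
\<close>

lemma tensor_hom_ext:
  assumes "module k M" "module k T"
    and g: "g \<in> module_hom k (tensor_power k M n) T" and h: "h \<in> module_hom k (tensor_power k M n) T"
    and eq: "\<And>xs. xs \<in> tuples M n \<Longrightarrow> g (tensor k M xs) = h (tensor k M xs)"
    and X: "X \<in> carrier (tensor_power k M n)"
  shows "g X = h X"
proof -
  interpret M: module k M by fact
  interpret T: module k T by fact
  let ?F = "free_module k (tuples M n)" and ?N = "tensor_kernel k M n"
  interpret quotient k ?F ?N by (rule quotient_tensor_kernel) fact
  have q: "(\<lambda>c. ?N +>\<^bsub>?F\<^esub> c) \<in> module_hom k ?F (tensor_power k M n)"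
    using coset_hom by (simp add: tensor_power_def)
  note gq = module_hom_comp[OF q g] and hq = module_hom_comp[OF q h]
  obtain c where c: "c \<in> carrier ?F" "X = ?N +>\<^bsub>?F\<^esub> c"
    using tensor_power_carrierE[OF assms(1) X] .
  have "g (?N +>\<^bsub>?F\<^esub> c) = h (?N +>\<^bsub>?F\<^esub> c)"
    using M.is_cring c(1)
  proof (induction c rule: free_module_induct)
    case zero
    show ?case using module_hom_zero[OF gq module_axioms T.module_axioms]
      module_hom_zero[OF hq module_axioms T.module_axioms] by simp
  next
    case (add c d)
    then show ?case by (simp add: module_hom_add[OF gq] module_hom_add[OF hq])
  next
    case (gen a xs)
    note xs = free_gen_closed[OF M.is_cring gen(2)]
    show ?case using gen(1) eq[OF gen(2)] tensor_eq_coset[OF gen(2), of k]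
      by (simp add: module_hom_smult[OF gq] module_hom_smult[OF hq] xs)
  qed
  then show ?thesis by (simp add: c(2))
qed

section \<open>Maps of two, three and four arguments\<close>

definition bilinear ::
  "('k, 'x) ring_scheme \<Rightarrow> ('k, 'm, 'y) module_scheme \<Rightarrow> ('k, 'n, 'y1) module_scheme \<Rightarrow>
    ('k, 't, 'z) module_scheme \<Rightarrow> ('m \<Rightarrow> 'n \<Rightarrow> 't) \<Rightarrow> bool"
  where "bilinear k M N T f \<longleftrightarrow>
    (\<forall>y\<in>carrier N. (\<lambda>x. f x y) \<in> module_hom k M T) \<and>
    (\<forall>x\<in>carrier M. (\<lambda>y. f x y) \<in> module_hom k N T)"

definition trilinear ::
  "('k, 'x) ring_scheme \<Rightarrow> ('k, 'm, 'y) module_scheme \<Rightarrow> ('k, 'n, 'y1) module_scheme \<Rightarrow>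
    ('k, 'p, 'y2) module_scheme \<Rightarrow> ('k, 't, 'z) module_scheme \<Rightarrow> ('m \<Rightarrow> 'n \<Rightarrow> 'p \<Rightarrow> 't) \<Rightarrow> bool"
  where "trilinear k M N P T f \<longleftrightarrow>
    (\<forall>y\<in>carrier N. \<forall>z\<in>carrier P. (\<lambda>x. f x y z) \<in> module_hom k M T) \<and>
    (\<forall>x\<in>carrier M. \<forall>z\<in>carrier P. (\<lambda>y. f x y z) \<in> module_hom k N T) \<and>
    (\<forall>x\<in>carrier M. \<forall>y\<in>carrier N. (\<lambda>z. f x y z) \<in> module_hom k P T)"

definition quadrilinear ::
  "('k, 'x) ring_scheme \<Rightarrow> ('k, 'm, 'y) module_scheme \<Rightarrow> ('k, 't, 'z) module_scheme \<Rightarrow>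
    ('m \<Rightarrow> 'm \<Rightarrow> 'm \<Rightarrow> 'm \<Rightarrow> 't) \<Rightarrow> bool"
  where "quadrilinear k M T f \<longleftrightarrow>
    (\<forall>y\<in>carrier M. \<forall>z\<in>carrier M. \<forall>w\<in>carrier M. (\<lambda>x. f x y z w) \<in> module_hom k M T) \<and>
    (\<forall>x\<in>carrier M. \<forall>z\<in>carrier M. \<forall>w\<in>carrier M. (\<lambda>y. f x y z w) \<in> module_hom k M T) \<and>
    (\<forall>x\<in>carrier M. \<forall>y\<in>carrier M. \<forall>w\<in>carrier M. (\<lambda>z. f x y z w) \<in> module_hom k M T) \<and>
    (\<forall>x\<in>carrier M. \<forall>y\<in>carrier M. \<forall>z\<in>carrier M. (\<lambda>w. f x y z w) \<in> module_hom k M T)"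

lemma bilinearI:
  assumes "\<And>y. y \<in> carrier N \<Longrightarrow> (\<lambda>x. f x y) \<in> module_hom k M T"
    and "\<And>x. x \<in> carrier M \<Longrightarrow> (\<lambda>y. f x y) \<in> module_hom k N T"
  shows "bilinear k M N T f"
  using assms by (simp add: bilinear_def)

lemma trilinearI:
  assumes "\<And>y z. \<lbrakk>y \<in> carrier N; z \<in> carrier P\<rbrakk> \<Longrightarrow> (\<lambda>x. f x y z) \<in> module_hom k M T"
    and "\<And>x z. \<lbrakk>x \<in> carrier M; z \<in> carrier P\<rbrakk> \<Longrightarrow> (\<lambda>y. f x y z) \<in> module_hom k N T"
    and "\<And>x y. \<lbrakk>x \<in> carrier M; y \<in> carrier N\<rbrakk> \<Longrightarrow> (\<lambda>z. f x y z) \<in> module_hom k P T"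
  shows "trilinear k M N P T f"
  using assms by (simp add: trilinear_def)

lemma quadrilinearI:
  assumes "\<And>y z w. \<lbrakk>y \<in> carrier M; z \<in> carrier M; w \<in> carrier M\<rbrakk> \<Longrightarrow> (\<lambda>x. f x y z w) \<in> module_hom k M T"
    and "\<And>x z w. \<lbrakk>x \<in> carrier M; z \<in> carrier M; w \<in> carrier M\<rbrakk> \<Longrightarrow> (\<lambda>y. f x y z w) \<in> module_hom k M T"
    and "\<And>x y w. \<lbrakk>x \<in> carrier M; y \<in> carrier M; w \<in> carrier M\<rbrakk> \<Longrightarrow> (\<lambda>z. f x y z w) \<in> module_hom k M T"
    and "\<And>x y z. \<lbrakk>x \<in> carrier M; y \<in> carrier M; z \<in> carrier M\<rbrakk> \<Longrightarrow> (\<lambda>w. f x y z w) \<in> module_hom k M T"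
  shows "quadrilinear k M T f"
  using assms by (simp add: quadrilinear_def)

text \<open>
  The next two facts are stated with a linear map substituted for one argument. In this form they
  can be applied backwards, as introduction rules that follow the shape of a term: to see that a
  long expression is linear in a variable, follow the path from the root to its only occurrence.
  The same holds of \<open>tensor2_hom\<close>, \<open>tensor3_hom\<close> and \<open>tensor4_hom\<close> below.
\<close>

lemma bilinear_hom:
  assumes "bilinear k M N T f"
  shows "\<lbrakk>g \<in> module_hom k L M; y \<in> carrier N\<rbrakk> \<Longrightarrow> (\<lambda>s. f (g s) y) \<in> module_hom k L T"
    and "\<lbrakk>x \<in> carrier M; h \<in> module_hom k L N\<rbrakk> \<Longrightarrow> (\<lambda>s. f x (h s)) \<in> module_hom k L T"
  using assms module_hom_comp[of g k L M "\<lambda>x. f x y" T] module_hom_comp[of h k L N "\<lambda>y. f x y" T]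
  by (simp_all add: bilinear_def)

lemma trilinear_hom:
  assumes "trilinear k M N P T f"
  shows "\<lbrakk>g \<in> module_hom k L M; y \<in> carrier N; z \<in> carrier P\<rbrakk> \<Longrightarrow> (\<lambda>s. f (g s) y z) \<in> module_hom k L T"
    and "\<lbrakk>x \<in> carrier M; g' \<in> module_hom k L N; z \<in> carrier P\<rbrakk> \<Longrightarrow> (\<lambda>s. f x (g' s) z) \<in> module_hom k L T"
    and "\<lbrakk>x \<in> carrier M; y \<in> carrier N; g'' \<in> module_hom k L P\<rbrakk> \<Longrightarrow> (\<lambda>s. f x y (g'' s)) \<in> module_hom k L T"
  using assms module_hom_comp[of g k L M "\<lambda>x. f x y z" T]
    module_hom_comp[of g' k L N "\<lambda>y. f x y z" T] module_hom_comp[of g'' k L P "\<lambda>z. f x y z" T]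
  by (simp_all add: trilinear_def)

lemma bilinear_closed:
  "\<lbrakk>bilinear k M N T f; x \<in> carrier M; y \<in> carrier N\<rbrakk> \<Longrightarrow> f x y \<in> carrier T"
  using module_hom_closed[of "\<lambda>x. f x y" k M T x] by (simp add: bilinear_def)

lemma trilinear_closed:
  "\<lbrakk>trilinear k M N P T f; x \<in> carrier M; y \<in> carrier N; z \<in> carrier P\<rbrakk> \<Longrightarrow> f x y z \<in> carrier T"
  using module_hom_closed[of "\<lambda>x. f x y z" k M T x] by (simp add: trilinear_def)

lemma quadrilinear_closed:
  "\<lbrakk>quadrilinear k M T f; x \<in> carrier M; y \<in> carrier M; z \<in> carrier M; w \<in> carrier M\<rbrakk> \<Longrightarrow>
    f x y z w \<in> carrier T"
  using module_hom_closed[of "\<lambda>x. f x y z w" k M T x] by (simp add: quadrilinear_def)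

lemma bilinear_cong:
  assumes "bilinear k M N T f" "module k M" "module k N"
    and eq: "\<And>x y. \<lbrakk>x \<in> carrier M; y \<in> carrier N\<rbrakk> \<Longrightarrow> f x y = g x y"
  shows "bilinear k M N T g"
proof (rule bilinearI)
  show "(\<lambda>x. g x y) \<in> module_hom k M T" if "y \<in> carrier N" for y
    using that assms by - (rule module_hom_cong[of "\<lambda>x. f x y"]; simp add: bilinear_def)
  show "(\<lambda>y. g x y) \<in> module_hom k N T" if "x \<in> carrier M" for x
    using that assms by - (rule module_hom_cong[of "\<lambda>y. f x y"]; simp add: bilinear_def)
qed

lemma trilinear_cong:
  assumes "trilinear k M N P T f" "module k M" "module k N" "module k P"
    and eq: "\<And>x y z. \<lbrakk>x \<in> carrier M; y \<in> carrier N; z \<in> carrier P\<rbrakk> \<Longrightarrow> f x y z = g x y z"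
  shows "trilinear k M N P T g"
proof (rule trilinearI)
  show "(\<lambda>x. g x y z) \<in> module_hom k M T" if "y \<in> carrier N" "z \<in> carrier P" for y z
    using that assms by - (rule module_hom_cong[of "\<lambda>x. f x y z"]; simp add: trilinear_def)
  show "(\<lambda>y. g x y z) \<in> module_hom k N T" if "x \<in> carrier M" "z \<in> carrier P" for x z
    using that assms by - (rule module_hom_cong[of "\<lambda>y. f x y z"]; simp add: trilinear_def)
  show "(\<lambda>z. g x y z) \<in> module_hom k P T" if "x \<in> carrier M" "y \<in> carrier N" for x y
    using that assms by - (rule module_hom_cong[of "\<lambda>z. f x y z"]; simp add: trilinear_def)
qed

lemma bilinear_multilinear:
  assumes "bilinear k M M T f" shows "multilinear k M T 2 (\<lambda>xs. f (xs ! 0) (xs ! 1))"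
  unfolding multilinear_def
proof (intro conjI ballI allI impI)
  show "(\<lambda>xs. f (xs ! 0) (xs ! 1)) \<in> tuples M 2 \<rightarrow> carrier T"
    using bilinear_closed[OF assms] by (auto simp: tuples_nth)
  fix xs and i :: nat assume xs: "xs \<in> tuples M 2" and "i < 2"
  then have "i = 0 \<or> i = 1" by auto
  moreover have "length xs = 2" using xs by (simp add: tuples_def)
  ultimately show "(\<lambda>x. f (xs[i := x] ! 0) (xs[i := x] ! 1)) \<in> module_hom k M T"
    using xs assms tuples_nth[OF xs]
    by (elim disjE) (simp_all add: bilinear_def)
qed

lemma trilinear_multilinear:
  assumes "trilinear k M M M T f" shows "multilinear k M T 3 (\<lambda>xs. f (xs ! 0) (xs ! 1) (xs ! 2))"
  unfolding multilinear_def
proof (intro conjI ballI allI impI)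
  show "(\<lambda>xs. f (xs ! 0) (xs ! 1) (xs ! 2)) \<in> tuples M 3 \<rightarrow> carrier T"
    using trilinear_closed[OF assms] by (auto simp: tuples_nth)
  fix xs and i :: nat assume xs: "xs \<in> tuples M 3" and "i < 3"
  then have "i = 0 \<or> i = 1 \<or> i = 2" by auto
  moreover have "length xs = 3" using xs by (simp add: tuples_def)
  ultimately show "(\<lambda>x. f (xs[i := x] ! 0) (xs[i := x] ! 1) (xs[i := x] ! 2)) \<in> module_hom k M T"
    using xs assms tuples_nth[OF xs]
    by (elim disjE) (simp_all add: trilinear_def)
qed

lemma quadrilinear_multilinear:
  assumes "quadrilinear k M T f"
  shows "multilinear k M T 4 (\<lambda>xs. f (xs ! 0) (xs ! 1) (xs ! 2) (xs ! 3))"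
  unfolding multilinear_def
proof (intro conjI ballI allI impI)
  show "(\<lambda>xs. f (xs ! 0) (xs ! 1) (xs ! 2) (xs ! 3)) \<in> tuples M 4 \<rightarrow> carrier T"
    using quadrilinear_closed[OF assms] by (auto simp: tuples_nth)
  fix xs and i :: nat assume xs: "xs \<in> tuples M 4" and "i < 4"
  then have "i = 0 \<or> i = 1 \<or> i = 2 \<or> i = 3" by auto
  moreover have "length xs = 4" using xs by (simp add: tuples_def)
  ultimately show "(\<lambda>x. f (xs[i := x] ! 0) (xs[i := x] ! 1) (xs[i := x] ! 2) (xs[i := x] ! 3))
      \<in> module_hom k M T"
    using xs assms tuples_nth[OF xs]
    by (elim disjE) (simp_all add: quadrilinear_def)
qed

lemma tensor_hom_update:
  assumes "module k M" "xs \<in> tuples M n" "i < n" "g \<in> module_hom k L M"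
  shows "(\<lambda>s. tensor k M (xs[i := g s])) \<in> module_hom k L (tensor_power k M n)"
  using assms(2,3) tensor_multilinear[OF assms(1), of n]
  by (intro module_hom_comp[OF assms(4), of "\<lambda>x. tensor k M (xs[i := x])"])
    (simp add: multilinear_def)

lemma tensor2_hom:
  assumes "module k M" "g \<in> module_hom k L M" "a \<in> carrier M"
  shows "(\<lambda>s. tensor k M [g s, a]) \<in> module_hom k L (tensor_power k M 2)"
    and "(\<lambda>s. tensor k M [a, g s]) \<in> module_hom k L (tensor_power k M 2)"
  using tensor_hom_update[OF assms(1) _ _ assms(2), of "[a, a]" 2 0]
    tensor_hom_update[OF assms(1) _ _ assms(2), of "[a, a]" 2 1] assms(3)
  by (simp_all add: tuples_def)

lemma tensor3_hom:
  assumes "module k M" "g \<in> module_hom k L M" "a \<in> carrier M" "b \<in> carrier M"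
  shows "(\<lambda>s. tensor k M [g s, a, b]) \<in> module_hom k L (tensor_power k M 3)"
    and "(\<lambda>s. tensor k M [a, g s, b]) \<in> module_hom k L (tensor_power k M 3)"
    and "(\<lambda>s. tensor k M [a, b, g s]) \<in> module_hom k L (tensor_power k M 3)"
  using tensor_hom_update[OF assms(1) _ _ assms(2), of "[a, a, b]" 3 0]
    tensor_hom_update[OF assms(1) _ _ assms(2), of "[a, a, b]" 3 1]
    tensor_hom_update[OF assms(1) _ _ assms(2), of "[a, b, b]" 3 2] assms(3,4)
  by (simp_all add: tuples_def numeral_2_eq_2)

lemma tensor4_hom:
  assumes "module k M" "g \<in> module_hom k L M" "a \<in> carrier M" "b \<in> carrier M" "c \<in> carrier M"
  shows "(\<lambda>s. tensor k M [g s, a, b, c]) \<in> module_hom k L (tensor_power k M 4)"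
    and "(\<lambda>s. tensor k M [a, g s, b, c]) \<in> module_hom k L (tensor_power k M 4)"
    and "(\<lambda>s. tensor k M [a, b, g s, c]) \<in> module_hom k L (tensor_power k M 4)"
    and "(\<lambda>s. tensor k M [a, b, c, g s]) \<in> module_hom k L (tensor_power k M 4)"
  using tensor_hom_update[OF assms(1) _ _ assms(2), of "[a, a, b, c]" 4 0]
    tensor_hom_update[OF assms(1) _ _ assms(2), of "[a, a, b, c]" 4 1]
    tensor_hom_update[OF assms(1) _ _ assms(2), of "[a, b, b, c]" 4 2]
    tensor_hom_update[OF assms(1) _ _ assms(2), of "[a, b, c, c]" 4 3] assms(3,4,5)
  by (simp_all add: tuples_def numeral_2_eq_2 numeral_3_eq_3)

text \<open>
  The coefficient of a tuple is absorbed into its entry at position 0, which exists as \<open>0 < n\<close>. The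
  identity map is the lift of \<^term>\<open>tensor k M\<close>, so the sum that defines the lift is a presentation of
  \<open>X\<close>. The sum is indexed by a set with a function on it, since distinct tuples may become equal when
  their coefficients are absorbed.
\<close>

lemma tensor_power_sum_of_tensors:
  assumes M: "module k M" and X: "X \<in> carrier (tensor_power k M n)" and n: "0 < n"
  obtains I :: "'m list set" and p :: "'m list \<Rightarrow> 'm list"
  where "finite I" "p \<in> I \<rightarrow> tuples M n"
    "X = (\<Oplus>\<^bsub>tensor_power k M n\<^esub>i\<in>I. tensor k M (p i))"
proof -
  interpret M: module k M by fact
  note T = module_tensor_power[OF M, of n]
  interpret T: module k "tensor_power k M n" by (rule T)
  note tm = tensor_multilinear[OF M, of n]
  obtain c where c: "c \<in> carrier (free_module k (tuples M n))"
    "X = tensor_kernel k M n +>\<^bsub>free_module k (tuples M n)\<^esub> c"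
    using tensor_power_carrierE[OF M X] .
  let ?I = "{xs. c xs \<noteq> \<zero>\<^bsub>k\<^esub>}" and ?p = "\<lambda>xs. xs[0 := c xs \<odot>\<^bsub>M\<^esub> xs ! 0]"
  have I: "finite ?I" "?I \<subseteq> tuples M n" and ck: "c xs \<in> carrier k" for xs
    using c(1) by (auto simp: free_module_simps)
  have hd: "xs ! 0 \<in> carrier M" if "xs \<in> ?I" for xs using that I n by (auto intro: tuples_nth)
  have p: "?p \<in> ?I \<rightarrow> tuples M n"
    using I hd ck by (auto intro!: tuples_update)
  have "X = tensor_lift k (tensor_power k M n) (tensor k M) X"
    by (rule tensor_hom_ext[OF M T module_hom_id tensor_lift_hom[OF M T tm] _ X])
      (simp add: tensor_lift_tensor[OF M T tm])
  also have "\<dots> = (\<Oplus>\<^bsub>tensor_power k M n\<^esub>xs\<in>?I. c xs \<odot>\<^bsub>tensor_power k M n\<^esub> tensor k M xs)"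
    by (simp only: c(2) tensor_lift_coset[OF M T tm c(1)] linear_extension_def)
  also have "\<dots> = (\<Oplus>\<^bsub>tensor_power k M n\<^esub>xs\<in>?I. tensor k M (?p xs))"
  proof (rule T.finsum_cong')
    show "(\<lambda>xs. tensor k M (?p xs)) \<in> ?I \<rightarrow> carrier (tensor_power k M n)"
      using p tensor_closed[OF M] by blast
    fix xs assume xs: "xs \<in> ?I"
    have "(\<lambda>x. tensor k M (xs[0 := x])) \<in> module_hom k M (tensor_power k M n)"
      using tm xs I(2) n by (auto simp: multilinear_def)
    from module_hom_smult[OF this ck hd[OF xs]]
    show "c xs \<odot>\<^bsub>tensor_power k M n\<^esub> tensor k M xs = tensor k M (?p xs)"
      by simp
  qed simp
  finally show ?thesis using that I(1) p by blast
qed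

lemma tensor_lift_sum:
  assumes "module k M" "module k T" "multilinear k M T n f" "p \<in> I \<rightarrow> tuples M n"
  shows "tensor_lift k T f (\<Oplus>\<^bsub>tensor_power k M n\<^esub>i\<in>I. tensor k M (p i)) = (\<Oplus>\<^bsub>T\<^esub>i\<in>I. f (p i))"
proof -
  interpret T: module k T by fact
  have "tensor_lift k T f (\<Oplus>\<^bsub>tensor_power k M n\<^esub>i\<in>I. tensor k M (p i)) =
      (\<Oplus>\<^bsub>T\<^esub>i\<in>I. tensor_lift k T f (tensor k M (p i)))"
    using assms(4) tensor_closed[OF assms(1)]
    by (intro module_hom_finsum[OF tensor_lift_hom] assms module_tensor_power) blast
  also have "\<dots> = (\<Oplus>\<^bsub>T\<^esub>i\<in>I. f (p i))"
    using assms(3,4) tensor_lift_tensor[OF assms(1-3)]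
    by (intro T.finsum_cong') (auto simp: multilinear_def)
  finally show ?thesis .
qed

text \<open>
  A lift only uses the additive group and the scalar multiplication of its target, and these are the
  same for the tensor power and for the algebra on it.
\<close>

lemma tensor_lift_algebra:
  "tensor_lift k (tensor_power_algebra k A n) f X = tensor_lift k (tensor_power k A n) f X"
  by (simp add: tensor_lift_def finsum_def tensor_power_algebra_def)

lemma sweedler3_algebra:
  "sweedler3 k (tensor_power_algebra k A n) f X = sweedler3 k (tensor_power k A n) f X"
  by (simp add: sweedler3_def tensor_lift_algebra)

section \<open>Summing over the components of a triple tensor\<close>

text \<open>
  \<open>f(X\<^sup>1, X\<^sup>2, X\<^sup>3)\<close>, summation understood, for \<open>X = \<Sum>\<^sub>i p\<^sub>i\<^sub>0 \<otimes> p\<^sub>i\<^sub>1 \<otimes> p\<^sub>i\<^sub>2\<close>. For trilinear \<open>f\<close> it agrees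
  with \<^const>\<open>sweedler3\<close>, but it is a plain finite sum: it commutes with every linear map and two such
  sums can be interchanged.
\<close>

definition sum3 :: "('k, 't, 'y) module_scheme \<Rightarrow> 'i set \<Rightarrow> ('i \<Rightarrow> 'm list) \<Rightarrow> ('m \<Rightarrow> 'm \<Rightarrow> 'm \<Rightarrow> 't) \<Rightarrow> 't"
  where "sum3 T I p f = (\<Oplus>\<^bsub>T\<^esub>i\<in>I. f (p i ! 0) (p i ! 1) (p i ! 2))"

locale tensor3_sum = module k M for k :: "('k, 'x) ring_scheme" and M :: "('k, 'm, 'y) module_scheme" +
  fixes I :: "'i set" and p :: "'i \<Rightarrow> 'm list" and X :: "('m list \<Rightarrow> 'k) set"
  assumes fin: "finite I" and p: "p \<in> I \<rightarrow> tuples M 3"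
    and X: "X = (\<Oplus>\<^bsub>tensor_power k M 3\<^esub>i\<in>I. tensor k M (p i))"
begin

lemma p_closed:
  assumes "i \<in> I" shows "p i ! 0 \<in> carrier M" "p i ! Suc 0 \<in> carrier M" "p i ! 2 \<in> carrier M"
  using assms p by (auto intro!: tuples_nth[of "p i" M 3])

lemma sum_closed:
  assumes "module k T"
    "\<And>x y z. \<lbrakk>x \<in> carrier M; y \<in> carrier M; z \<in> carrier M\<rbrakk> \<Longrightarrow> f x y z \<in> carrier T"
  shows "sum3 T I p f \<in> carrier T"
proof -
  interpret T: module k T by fact
  show ?thesis unfolding sum3_def by (rule T.finsum_closed) (use assms p_closed in auto)
qed

lemma sum_cong:
  assumes "module k T"
    "\<And>x y z. \<lbrakk>x \<in> carrier M; y \<in> carrier M; z \<in> carrier M\<rbrakk> \<Longrightarrow> g x y z \<in> carrier T"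
    "\<And>x y z. \<lbrakk>x \<in> carrier M; y \<in> carrier M; z \<in> carrier M\<rbrakk> \<Longrightarrow> f x y z = g x y z"
  shows "sum3 T I p f = sum3 T I p g"
proof -
  interpret T: module k T by fact
  show ?thesis unfolding sum3_def by (rule T.finsum_cong') (use assms p_closed in auto)
qed

lemma sum_linear:
  assumes "module k N" "module k T"
    "\<And>x y z. \<lbrakk>x \<in> carrier M; y \<in> carrier M; z \<in> carrier M\<rbrakk> \<Longrightarrow> (\<lambda>s. f s x y z) \<in> module_hom k N T"
  shows "(\<lambda>s. sum3 T I p (f s)) \<in> module_hom k N T"
  unfolding sum3_def by (rule module_hom_sum) (use assms fin p_closed in auto)

lemma hom_of_sum:
  assumes "h \<in> module_hom k N T" "module k N" "module k T"
    "\<And>x y z. \<lbrakk>x \<in> carrier M; y \<in> carrier M; z \<in> carrier M\<rbrakk> \<Longrightarrow> f x y z \<in> carrier N"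
  shows "h (sum3 N I p f) = sum3 T I p (\<lambda>x y z. h (f x y z))"
  unfolding sum3_def by (rule module_hom_finsum) (use assms p_closed in auto)

lemma tensor_lift_eq_sum:
  assumes "module k T" "multilinear k M T 3 f"
  shows "tensor_lift k T f X = sum3 T I p (\<lambda>x y z. f [x, y, z])"
proof -
  interpret T: module k T by fact
  have "tensor_lift k T f X = (\<Oplus>\<^bsub>T\<^esub>i\<in>I. f (p i))"
    unfolding X by (rule tensor_lift_sum) (use assms p module_axioms in auto)
  also have "\<dots> = sum3 T I p (\<lambda>x y z. f [x, y, z])"
  proof -
    have "p i = [p i ! 0, p i ! 1, p i ! 2]" if "i \<in> I" for i
      using p that by (intro tuples3_eq) blast
    then show ?thesis
      unfolding sum3_def using assms(2) p
      by (intro T.finsum_cong') (auto simp: multilinear_def Pi_def)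
  qed
  finally show ?thesis .
qed

lemma sweedler3_eq_sum:
  assumes "module k T" "trilinear k M M M T f"
  shows "sweedler3 k T f X = sum3 T I p f"
  unfolding sweedler3_def tensor_lift_eq_sum[OF assms(1) trilinear_multilinear[OF assms(2)]]
  by simp

end

lemma sum3_swap:
  assumes "tensor3_sum k M I p X" "tensor3_sum k N J q Y" "module k T"
    "\<And>x y z u v w. \<lbrakk>x \<in> carrier M; y \<in> carrier M; z \<in> carrier M;
        u \<in> carrier N; v \<in> carrier N; w \<in> carrier N\<rbrakk> \<Longrightarrow> f x y z u v w \<in> carrier T"
  shows "sum3 T I p (\<lambda>x y z. sum3 T J q (\<lambda>u v w. f x y z u v w)) =
    sum3 T J q (\<lambda>u v w. sum3 T I p (\<lambda>x y z. f x y z u v w))"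
proof -
  interpret M: tensor3_sum k M I p X by fact
  interpret N: tensor3_sum k N J q Y by fact
  show ?thesis
    unfolding sum3_def
    by (rule finsum_swap[OF assms(3) M.fin N.fin]) (use assms(4) M.p_closed N.p_closed in auto)
qed

section \<open>The axioms of a canonical R-matrix inside multilinear maps\<close>

text \<open>
  A presentation as a sum of pure tensors is fixed for \<open>R\<close> and for a right inverse \<open>S\<close> of \<open>R\<close>. Nothing
  depends on its choice; it makes all identities below statements about finite sums.
\<close>

locale canonical_R = A: assoc_algebra k A
  for k :: "('k, 'x) ring_scheme" and A :: "('k, 'a, 'y) module_scheme" +
  fixes I :: "'i set" and p :: "'i \<Rightarrow> 'a list" and R :: "('a list \<Rightarrow> 'k) set"
    and J :: "'j set" and q :: "'j \<Rightarrow> 'a list" and S :: "('a list \<Rightarrow> 'k) set"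
  assumes canonical: "canonical_R_matrix k A R"
    and R_sum: "tensor3_sum k A I p R" and S_sum: "tensor3_sum k A J q S"
    and R_inverse: "R \<otimes>\<^bsub>tensor_power_algebra k A 3\<^esub> S = \<one>\<^bsub>tensor_power_algebra k A 3\<^esub>"
begin

sublocale R: tensor3_sum k A I p R by (rule R_sum)
sublocale S: tensor3_sum k A J q S by (rule S_sum)

lemma module_A: "module k A" by (rule A.module_axioms)

lemma mult_hom:
  assumes "a \<in> carrier A"
  shows "g \<in> module_hom k L A \<Longrightarrow> (\<lambda>s. a \<otimes>\<^bsub>A\<^esub> g s) \<in> module_hom k L A"
    and "g \<in> module_hom k L A \<Longrightarrow> (\<lambda>s. g s \<otimes>\<^bsub>A\<^esub> a) \<in> module_hom k L A"
  using assms
  by (auto simp: module_hom_def Pi_def A.r_distr A.l_distr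
      A.smult_mult_left[symmetric] A.smult_mult_right[symmetric])

lemmas hom_intros = module_hom_id mult_hom tensor3_hom[OF module_A] tensor4_hom[OF module_A]

lemma lift3_eq:
  assumes "module k T" "trilinear k A A A T f" "x \<in> carrier A" "y \<in> carrier A" "z \<in> carrier A"
  shows "tensor_lift k T (\<lambda>xs. f (xs ! 0) (xs ! 1) (xs ! 2)) (tensor k A [x, y, z]) = f x y z"
  using assms
  by (subst tensor_lift_tensor[OF module_A _ trilinear_multilinear]) (auto simp: tuples_def)

lemma lift4_eq:
  assumes "module k T" "quadrilinear k A T f"
    "x \<in> carrier A" "y \<in> carrier A" "z \<in> carrier A" "w \<in> carrier A"
  shows "tensor_lift k T (\<lambda>xs. f (xs ! 0) (xs ! 1) (xs ! 2) (xs ! 3)) (tensor k A [x, y, z, w]) = f x y z w"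
  using assms
  by (subst tensor_lift_tensor[OF module_A _ quadrilinear_multilinear]) (auto simp: tuples_def)

abbreviation Rsum :: "('k, 't, 'u) module_scheme \<Rightarrow> ('a \<Rightarrow> 'a \<Rightarrow> 'a \<Rightarrow> 't) \<Rightarrow> 't"
  where "Rsum T \<equiv> sum3 T I p"

abbreviation Ssum :: "('k, 't, 'u) module_scheme \<Rightarrow> ('a \<Rightarrow> 'a \<Rightarrow> 'a \<Rightarrow> 't) \<Rightarrow> 't"
  where "Ssum T \<equiv> sum3 T J q"

text \<open>
  An equation in \<open>A \<otimes> A \<otimes> A\<close> becomes, for each trilinear \<open>f\<close> into an arbitrary module, the equation
  obtained by applying the linear map that \<open>f\<close> induces. The axioms are used only in this form, with
  the left-over factors of a longer product hidden in \<open>f\<close>.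
\<close>

lemma Rsum_transfer:
  assumes T: "module k T" and f: "trilinear k A A A T f"
    and g: "trilinear k A A A (tensor_power k A 3) (\<lambda>x y z. tensor k A [g1 x y z, g2 x y z, g3 x y z])"
    and h: "trilinear k A A A (tensor_power k A 3) (\<lambda>x y z. tensor k A [h1 x y z, h2 x y z, h3 x y z])"
    and gc: "\<And>x y z. \<lbrakk>x \<in> carrier A; y \<in> carrier A; z \<in> carrier A\<rbrakk> \<Longrightarrow>
      g1 x y z \<in> carrier A \<and> g2 x y z \<in> carrier A \<and> g3 x y z \<in> carrier A"
    and hc: "\<And>x y z. \<lbrakk>x \<in> carrier A; y \<in> carrier A; z \<in> carrier A\<rbrakk> \<Longrightarrow>
      h1 x y z \<in> carrier A \<and> h2 x y z \<in> carrier A \<and> h3 x y z \<in> carrier A"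
    and eq: "sweedler3 k (tensor_power_algebra k A 3) (\<lambda>x y z. tensor k A [g1 x y z, g2 x y z, g3 x y z]) R =
      sweedler3 k (tensor_power_algebra k A 3) (\<lambda>x y z. tensor k A [h1 x y z, h2 x y z, h3 x y z]) R"
  shows "Rsum T (\<lambda>x y z. f (g1 x y z) (g2 x y z) (g3 x y z)) =
    Rsum T (\<lambda>x y z. f (h1 x y z) (h2 x y z) (h3 x y z))"
proof -
  let ?L = "tensor_lift k T (\<lambda>xs. f (xs ! 0) (xs ! 1) (xs ! 2))" and ?T3 = "tensor_power k A 3"
  have L: "?L \<in> module_hom k ?T3 T"
    by (rule tensor_lift_hom[OF module_A T trilinear_multilinear[OF f]])
  note T3 = module_tensor_power[OF module_A, of 3]
  have key: "?L (sweedler3 k ?T3 (\<lambda>x y z. tensor k A [u1 x y z, u2 x y z, u3 x y z]) R) =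
      Rsum T (\<lambda>x y z. f (u1 x y z) (u2 x y z) (u3 x y z))"
    if u: "trilinear k A A A ?T3 (\<lambda>x y z. tensor k A [u1 x y z, u2 x y z, u3 x y z])"
      "\<And>x y z. \<lbrakk>x \<in> carrier A; y \<in> carrier A; z \<in> carrier A\<rbrakk> \<Longrightarrow>
        u1 x y z \<in> carrier A \<and> u2 x y z \<in> carrier A \<and> u3 x y z \<in> carrier A" for u1 u2 u3
  proof -
    have "?L (sweedler3 k ?T3 (\<lambda>x y z. tensor k A [u1 x y z, u2 x y z, u3 x y z]) R) =
        Rsum T (\<lambda>x y z. ?L (tensor k A [u1 x y z, u2 x y z, u3 x y z]))"
      unfolding R.sweedler3_eq_sum[OF T3 u(1)]
      by (rule R.hom_of_sum[OF L T3 T]) (rule trilinear_closed[OF u(1)])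
    also have "\<dots> = Rsum T (\<lambda>x y z. f (u1 x y z) (u2 x y z) (u3 x y z))"
      using u(2) by (intro R.sum_cong[OF T] lift3_eq[OF T f] trilinear_closed[OF f]) auto
    finally show ?thesis .
  qed
  show ?thesis
    using key[OF g gc] key[OF h hc] eq by (simp only: sweedler3_algebra)
qed

text \<open>
  The first three axioms move an algebra element between the components of \<open>R\<close>.
\<close>

lemma R_third_first:
  assumes T: "module k T" and f: "trilinear k A A A T f" and a: "a \<in> carrier A"
  shows "Rsum T (\<lambda>x y z. f x y (a \<otimes>\<^bsub>A\<^esub> z)) = Rsum T (\<lambda>x y z. f (x \<otimes>\<^bsub>A\<^esub> a) y z)"
  by (rule Rsum_transfer[OF T f])
    (use a canonical in \<open>auto intro!: trilinearI hom_intros simp: canonical_R_matrix_def Let_def\<close>)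

lemma R_first_second:
  assumes T: "module k T" and f: "trilinear k A A A T f" and a: "a \<in> carrier A"
  shows "Rsum T (\<lambda>x y z. f (a \<otimes>\<^bsub>A\<^esub> x) y z) = Rsum T (\<lambda>x y z. f x (y \<otimes>\<^bsub>A\<^esub> a) z)"
  by (rule Rsum_transfer[OF T f])
    (use a canonical in \<open>auto intro!: trilinearI hom_intros simp: canonical_R_matrix_def Let_def\<close>)

lemma R_second_third:
  assumes T: "module k T" and f: "trilinear k A A A T f" and a: "a \<in> carrier A"
  shows "Rsum T (\<lambda>x y z. f x (a \<otimes>\<^bsub>A\<^esub> y) z) = Rsum T (\<lambda>x y z. f x y (z \<otimes>\<^bsub>A\<^esub> a))"
  by (rule Rsum_transfer[OF T f])
    (use a canonical in \<open>auto intro!: trilinearI hom_intros simp: canonical_R_matrix_def Let_def\<close>)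

text \<open>
  The axioms in \<open>A \<otimes> A \<otimes> A \<otimes> A\<close> are used through the linear map that a quadrilinear \<open>f\<close> induces. This
  lemma evaluates it on the sides with two copies of \<open>R\<close>, the next one on those with one copy. Linearity
  in the components of each copy is what makes the nested lifts well defined.
\<close>

lemma lift_double_Rsum:
  assumes T: "module k T" and f: "quadrilinear k A T f"
    and c: "\<And>u v w x y z. \<lbrakk>u \<in> carrier A; v \<in> carrier A; w \<in> carrier A;
        x \<in> carrier A; y \<in> carrier A; z \<in> carrier A\<rbrakk> \<Longrightarrow>
      g1 u v w x y z \<in> carrier A \<and> g2 u v w x y z \<in> carrier A \<and>
      g3 u v w x y z \<in> carrier A \<and> g4 u v w x y z \<in> carrier A"
    and outer: "\<And>x y z. \<lbrakk>x \<in> carrier A; y \<in> carrier A; z \<in> carrier A\<rbrakk> \<Longrightarrow>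
      trilinear k A A A (tensor_power k A 4)
        (\<lambda>u v w. tensor k A [g1 u v w x y z, g2 u v w x y z, g3 u v w x y z, g4 u v w x y z])"
    and inner: "\<And>u v w. \<lbrakk>u \<in> carrier A; v \<in> carrier A; w \<in> carrier A\<rbrakk> \<Longrightarrow>
      trilinear k A A A (tensor_power k A 4)
        (\<lambda>x y z. tensor k A [g1 u v w x y z, g2 u v w x y z, g3 u v w x y z, g4 u v w x y z])"
  shows "tensor_lift k T (\<lambda>xs. f (xs ! 0) (xs ! 1) (xs ! 2) (xs ! 3))
      (sweedler3 k (tensor_power_algebra k A 4) (\<lambda>u v w. sweedler3 k (tensor_power_algebra k A 4) (\<lambda>x y z.
        tensor k A [g1 u v w x y z, g2 u v w x y z, g3 u v w x y z, g4 u v w x y z]) R) R) =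
    Rsum T (\<lambda>u v w. Rsum T (\<lambda>x y z. f (g1 u v w x y z) (g2 u v w x y z) (g3 u v w x y z) (g4 u v w x y z)))"
proof -
  let ?L = "tensor_lift k T (\<lambda>xs. f (xs ! 0) (xs ! 1) (xs ! 2) (xs ! 3))" and ?T4 = "tensor_power k A 4"
  let ?g = "\<lambda>u v w x y z. tensor k A [g1 u v w x y z, g2 u v w x y z, g3 u v w x y z, g4 u v w x y z]"
  let ?f = "\<lambda>u v w x y z. f (g1 u v w x y z) (g2 u v w x y z) (g3 u v w x y z) (g4 u v w x y z)"
  have L: "?L \<in> module_hom k ?T4 T"
    by (rule tensor_lift_hom[OF module_A T quadrilinear_multilinear[OF f]])
  note T4 = module_tensor_power[OF module_A, of 4]
  note gc = trilinear_closed[OF inner]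
  have in_eq: "sweedler3 k ?T4 (?g u v w) R = Rsum ?T4 (?g u v w)"
    if "u \<in> carrier A" "v \<in> carrier A" "w \<in> carrier A" for u v w
    using that by (intro R.sweedler3_eq_sum T4 inner)
  have tri: "trilinear k A A A ?T4 (\<lambda>u v w. Rsum ?T4 (?g u v w))"
    using outer by (intro trilinearI R.sum_linear module_A T4) (simp_all add: trilinear_def)
  have "sweedler3 k ?T4 (\<lambda>u v w. sweedler3 k ?T4 (?g u v w) R) R =
      Rsum ?T4 (\<lambda>u v w. sweedler3 k ?T4 (?g u v w) R)"
    by (intro R.sweedler3_eq_sum T4 trilinear_cong[OF tri] module_A) (simp add: in_eq)
  also have "\<dots> = Rsum ?T4 (\<lambda>u v w. Rsum ?T4 (?g u v w))"
    by (intro R.sum_cong T4 in_eq R.sum_closed gc)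
  finally have "?L (sweedler3 k ?T4 (\<lambda>u v w. sweedler3 k ?T4 (?g u v w) R) R) =
      ?L (Rsum ?T4 (\<lambda>u v w. Rsum ?T4 (?g u v w)))"
    by (rule arg_cong)
  also have "\<dots> = Rsum T (\<lambda>u v w. ?L (Rsum ?T4 (?g u v w)))"
    by (intro R.hom_of_sum[OF L T4 T] R.sum_closed T4 gc)
  also have "\<dots> = Rsum T (\<lambda>u v w. Rsum T (?f u v w))"
  proof (intro R.sum_cong T R.sum_closed)
    fix u v w assume uvw: "u \<in> carrier A" "v \<in> carrier A" "w \<in> carrier A"
    have "?L (Rsum ?T4 (?g u v w)) = Rsum T (\<lambda>x y z. ?L (?g u v w x y z))"
      using uvw by (intro R.hom_of_sum[OF L T4 T] gc)
    also have "\<dots> = Rsum T (?f u v w)"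
      using uvw c by (intro R.sum_cong T lift4_eq[OF T f] quadrilinear_closed[OF f]) simp_all
    finally show "?L (Rsum ?T4 (?g u v w)) = Rsum T (?f u v w)" .
  qed (use c in \<open>auto intro: quadrilinear_closed[OF f]\<close>)
  finally show ?thesis by (simp only: sweedler3_algebra)
qed

lemma lift_Rsum:
  assumes T: "module k T" and f: "quadrilinear k A T f"
    and c: "\<And>x y z. \<lbrakk>x \<in> carrier A; y \<in> carrier A; z \<in> carrier A\<rbrakk> \<Longrightarrow>
      g1 x y z \<in> carrier A \<and> g2 x y z \<in> carrier A \<and> g3 x y z \<in> carrier A \<and> g4 x y z \<in> carrier A"
    and g: "trilinear k A A A (tensor_power k A 4)
        (\<lambda>x y z. tensor k A [g1 x y z, g2 x y z, g3 x y z, g4 x y z])"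
  shows "tensor_lift k T (\<lambda>xs. f (xs ! 0) (xs ! 1) (xs ! 2) (xs ! 3))
      (sweedler3 k (tensor_power_algebra k A 4) (\<lambda>x y z. tensor k A [g1 x y z, g2 x y z, g3 x y z, g4 x y z]) R) =
    Rsum T (\<lambda>x y z. f (g1 x y z) (g2 x y z) (g3 x y z) (g4 x y z))"
proof -
  let ?L = "tensor_lift k T (\<lambda>xs. f (xs ! 0) (xs ! 1) (xs ! 2) (xs ! 3))" and ?T4 = "tensor_power k A 4"
  let ?g = "\<lambda>x y z. tensor k A [g1 x y z, g2 x y z, g3 x y z, g4 x y z]"
  have L: "?L \<in> module_hom k ?T4 T"
    by (rule tensor_lift_hom[OF module_A T quadrilinear_multilinear[OF f]])
  note T4 = module_tensor_power[OF module_A, of 4]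
  have "?L (sweedler3 k ?T4 ?g R) = Rsum T (\<lambda>x y z. ?L (?g x y z))"
    unfolding R.sweedler3_eq_sum[OF T4 g]
    by (rule R.hom_of_sum[OF L T4 T]) (rule trilinear_closed[OF g])
  also have "\<dots> = Rsum T (\<lambda>x y z. f (g1 x y z) (g2 x y z) (g3 x y z) (g4 x y z))"
    using c by (intro R.sum_cong T lift4_eq[OF T f] quadrilinear_closed[OF f]) simp_all
  finally show ?thesis by (simp only: sweedler3_algebra)
qed

lemma R_insert_third:
  assumes T: "module k T" and f: "quadrilinear k A T f"
  shows "Rsum T (\<lambda>x y z. f x y \<one>\<^bsub>A\<^esub> z) =
    Rsum T (\<lambda>u v w. Rsum T (\<lambda>x y z. f (u \<otimes>\<^bsub>A\<^esub> x) v (w \<otimes>\<^bsub>A\<^esub> y) z))"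
proof -
  let ?L = "tensor_lift k T (\<lambda>xs. f (xs ! 0) (xs ! 1) (xs ! 2) (xs ! 3))"
  let ?s = "sweedler3 k (tensor_power_algebra k A 4)"
  let ?l = "?s (\<lambda>x y z. tensor k A [x, y, \<one>\<^bsub>A\<^esub>, z]) R"
  let ?r = "?s (\<lambda>u v w. ?s (\<lambda>x y z. tensor k A [u \<otimes>\<^bsub>A\<^esub> x, v, w \<otimes>\<^bsub>A\<^esub> y, z]) R) R"
  have "?l = ?r" using canonical by (simp add: canonical_R_matrix_def Let_def)
  then have "?L ?l = ?L ?r" by (rule arg_cong)
  then show ?thesis
    by (rule box_equals; intro lift_Rsum[OF T f] lift_double_Rsum[OF T f])
      (auto intro!: trilinearI hom_intros)
qed

lemma R_insert_second:
  assumes T: "module k T" and f: "quadrilinear k A T f"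
  shows "Rsum T (\<lambda>x y z. f x \<one>\<^bsub>A\<^esub> y z) =
    Rsum T (\<lambda>u v w. Rsum T (\<lambda>x y z. f x (y \<otimes>\<^bsub>A\<^esub> u) v (z \<otimes>\<^bsub>A\<^esub> w)))"
proof -
  let ?L = "tensor_lift k T (\<lambda>xs. f (xs ! 0) (xs ! 1) (xs ! 2) (xs ! 3))"
  let ?s = "sweedler3 k (tensor_power_algebra k A 4)"
  let ?l = "?s (\<lambda>x y z. tensor k A [x, \<one>\<^bsub>A\<^esub>, y, z]) R"
  let ?r = "?s (\<lambda>u v w. ?s (\<lambda>x y z. tensor k A [x, y \<otimes>\<^bsub>A\<^esub> u, v, z \<otimes>\<^bsub>A\<^esub> w]) R) R"
  have "?l = ?r" using canonical by (simp add: canonical_R_matrix_def Let_def)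
  then have "?L ?l = ?L ?r" by (rule arg_cong)
  then show ?thesis
    by (rule box_equals; intro lift_Rsum[OF T f] lift_double_Rsum[OF T f])
      (auto intro!: trilinearI hom_intros)
qed

lemma R_times_S:
  assumes T: "module k T" and f: "trilinear k A A A T f"
  shows "Rsum T (\<lambda>x y z. Ssum T (\<lambda>u v w. f (x \<otimes>\<^bsub>A\<^esub> u) (y \<otimes>\<^bsub>A\<^esub> v) (z \<otimes>\<^bsub>A\<^esub> w))) =
    f \<one>\<^bsub>A\<^esub> \<one>\<^bsub>A\<^esub> \<one>\<^bsub>A\<^esub>"
proof -
  let ?L = "tensor_lift k T (\<lambda>xs. f (xs ! 0) (xs ! 1) (xs ! 2))" and ?T3 = "tensor_power k A 3"
  let ?g = "\<lambda>x y z u v w. tensor k A [x \<otimes>\<^bsub>A\<^esub> u, y \<otimes>\<^bsub>A\<^esub> v, z \<otimes>\<^bsub>A\<^esub> w]"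
  let ?f = "\<lambda>x y z u v w. f (x \<otimes>\<^bsub>A\<^esub> u) (y \<otimes>\<^bsub>A\<^esub> v) (z \<otimes>\<^bsub>A\<^esub> w)"
  have L: "?L \<in> module_hom k ?T3 T"
    by (rule tensor_lift_hom[OF module_A T trilinear_multilinear[OF f]])
  note T3 = module_tensor_power[OF module_A, of 3]
  have inner: "trilinear k A A A ?T3 (?g x y z)"
    if "x \<in> carrier A" "y \<in> carrier A" "z \<in> carrier A" for x y z
    using that by (auto intro!: trilinearI hom_intros)
  note gc = trilinear_closed[OF inner]
  have outer: "trilinear k A A A ?T3 (\<lambda>x y z. Ssum ?T3 (?g x y z))"
    by (auto intro!: trilinearI S.sum_linear[OF module_A T3] hom_intros)
  have in_eq: "tensor_lift k ?T3 (\<lambda>ys. tensor k A (map2 (\<otimes>\<^bsub>A\<^esub>) xs ys)) S =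
      Ssum ?T3 (?g (xs ! 0) (xs ! 1) (xs ! 2))" if xs: "xs \<in> tuples A 3" for xs
  proof -
    have m: "multilinear k A ?T3 3 (\<lambda>ys. tensor k A (map2 (\<otimes>\<^bsub>A\<^esub>) xs ys))"
      using xs tuples_nth[OF xs]
      by (intro multilinear_cong[OF trilinear_multilinear[OF inner] module_A])
        (auto simp: map2_tuples3)
    show ?thesis unfolding S.tensor_lift_eq_sum[OF T3 m]
      using tuples_nth[OF xs] gc
      by (intro S.sum_cong T3) (auto simp: map2_tuples3[OF xs] tuples_def)
  qed
  have m: "multilinear k A ?T3 3 (\<lambda>xs. tensor_lift k ?T3 (\<lambda>ys. tensor k A (map2 (\<otimes>\<^bsub>A\<^esub>) xs ys)) S)"
    by (rule multilinear_cong[OF trilinear_multilinear[OF outer] module_A]) (simp add: in_eq)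
  have "tensor k A [\<one>\<^bsub>A\<^esub>, \<one>\<^bsub>A\<^esub>, \<one>\<^bsub>A\<^esub>] = R \<otimes>\<^bsub>tensor_power_algebra k A 3\<^esub> S"
    unfolding R_inverse by (simp add: tensor_power_algebra_def numeral_3_eq_3)
  also have "\<dots> = tensor_lift k ?T3 (\<lambda>xs. tensor_lift k ?T3 (\<lambda>ys. tensor k A (map2 (\<otimes>\<^bsub>A\<^esub>) xs ys)) S) R"
    by (simp add: tensor_power_algebra_def)
  also have "\<dots> = Rsum ?T3 (\<lambda>x y z. Ssum ?T3 (?g x y z))"
    unfolding R.tensor_lift_eq_sum[OF T3 m]
    by (intro R.sum_cong T3 S.sum_closed) (auto simp: in_eq tuples_def gc)
  finally have "?L (tensor k A [\<one>\<^bsub>A\<^esub>, \<one>\<^bsub>A\<^esub>, \<one>\<^bsub>A\<^esub>]) =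
      ?L (Rsum ?T3 (\<lambda>x y z. Ssum ?T3 (?g x y z)))"
    by (rule arg_cong)
  also have "\<dots> = Rsum T (\<lambda>x y z. ?L (Ssum ?T3 (?g x y z)))"
    by (intro R.hom_of_sum[OF L T3 T] S.sum_closed T3 gc)
  also have "\<dots> = Rsum T (\<lambda>x y z. Ssum T (?f x y z))"
  proof (intro R.sum_cong T S.sum_closed)
    fix x y z assume xyz: "x \<in> carrier A" "y \<in> carrier A" "z \<in> carrier A"
    have "?L (Ssum ?T3 (?g x y z)) = Ssum T (\<lambda>u v w. ?L (?g x y z u v w))"
      using xyz by (intro S.hom_of_sum[OF L T3 T] gc)
    also have "\<dots> = Ssum T (?f x y z)"
      using xyz by (intro S.sum_cong T lift3_eq[OF T f] trilinear_closed[OF f]) simp_all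
    finally show "?L (Ssum ?T3 (?g x y z)) = Ssum T (?f x y z)" .
  qed (auto intro: trilinear_closed[OF f])
  finally show ?thesis using lift3_eq[OF T f, of "\<one>\<^bsub>A\<^esub>" "\<one>\<^bsub>A\<^esub>" "\<one>\<^bsub>A\<^esub>"] by simp
qed

section \<open>Contractions of the R-matrix\<close>

text \<open>
  Moving \<open>R\<^sup>1\<close> with the first axiom and \<open>r\<^sup>3\<close> with the third turns the fourth axiom
  into \<open>R\<^sup>1 \<otimes> R\<^sup>2 \<otimes> 1 \<otimes> R\<^sup>3 = r\<^sup>1 \<otimes> r\<^sup>2 \<otimes> R\<^sup>1R\<^sup>2 \<otimes> R\<^sup>3r\<^sup>3\<close>. Multiply from the right by \<open>S\<close> in the tensor
  factors 1, 2 and 4, where \<open>R\<close> on the left and \<open>r\<close> on the right cancel, and then multiply the first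
  three factors together. In the calculation \<open>(x, y, z)\<close> stands for \<open>R\<close>, \<open>(u, v, w)\<close> for \<open>r\<close> and
  \<open>(a, b, c)\<close> for \<open>S\<close>.
\<close>

lemma R_first_times_second:
  assumes T: "module k T" and \<psi>: "bilinear k A A T \<psi>"
  shows "Rsum T (\<lambda>x y z. \<psi> (x \<otimes>\<^bsub>A\<^esub> y) z) = \<psi> \<one>\<^bsub>A\<^esub> \<one>\<^bsub>A\<^esub>"
proof -
  note homs = hom_intros bilinear_hom[OF \<psi>] S.sum_linear[OF module_A T]
  note closed = bilinear_closed[OF \<psi>] R.sum_closed[OF T] S.sum_closed[OF T]
  note cong = R.sum_cong[OF T] S.sum_cong[OF T]
  have "\<psi> \<one>\<^bsub>A\<^esub> \<one>\<^bsub>A\<^esub> = Rsum T (\<lambda>x y z. Ssum T (\<lambda>a b c.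
      \<psi> (((x \<otimes>\<^bsub>A\<^esub> a) \<otimes>\<^bsub>A\<^esub> (y \<otimes>\<^bsub>A\<^esub> b)) \<otimes>\<^bsub>A\<^esub> \<one>\<^bsub>A\<^esub>) (z \<otimes>\<^bsub>A\<^esub> c)))"
    by (subst R_times_S[OF T, of "\<lambda>x y z. \<psi> ((x \<otimes>\<^bsub>A\<^esub> y) \<otimes>\<^bsub>A\<^esub> \<one>\<^bsub>A\<^esub>) z"])
      (auto intro!: trilinearI homs)
  also have "\<dots> = Rsum T (\<lambda>u v w. Rsum T (\<lambda>x y z. Ssum T (\<lambda>a b c.
      \<psi> ((((u \<otimes>\<^bsub>A\<^esub> x) \<otimes>\<^bsub>A\<^esub> a) \<otimes>\<^bsub>A\<^esub> (v \<otimes>\<^bsub>A\<^esub> b)) \<otimes>\<^bsub>A\<^esub> (w \<otimes>\<^bsub>A\<^esub> y)) (z \<otimes>\<^bsub>A\<^esub> c))))"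
    by (rule R_insert_third[OF T, of "\<lambda>x y z w. Ssum T (\<lambda>a b c.
        \<psi> (((x \<otimes>\<^bsub>A\<^esub> a) \<otimes>\<^bsub>A\<^esub> (y \<otimes>\<^bsub>A\<^esub> b)) \<otimes>\<^bsub>A\<^esub> z) (w \<otimes>\<^bsub>A\<^esub> c))"])
      (auto intro!: quadrilinearI homs)
  also have "\<dots> = Rsum T (\<lambda>x y z. Rsum T (\<lambda>u v w. Ssum T (\<lambda>a b c.
      \<psi> ((((u \<otimes>\<^bsub>A\<^esub> x) \<otimes>\<^bsub>A\<^esub> a) \<otimes>\<^bsub>A\<^esub> (v \<otimes>\<^bsub>A\<^esub> b)) \<otimes>\<^bsub>A\<^esub> (w \<otimes>\<^bsub>A\<^esub> y)) (z \<otimes>\<^bsub>A\<^esub> c))))"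
    by (rule sum3_swap[OF R_sum R_sum T]) (auto intro!: closed)
  also have "\<dots> = Rsum T (\<lambda>x y z. Rsum T (\<lambda>u v w. Ssum T (\<lambda>a b c.
      \<psi> (((u \<otimes>\<^bsub>A\<^esub> a) \<otimes>\<^bsub>A\<^esub> (v \<otimes>\<^bsub>A\<^esub> b)) \<otimes>\<^bsub>A\<^esub> ((x \<otimes>\<^bsub>A\<^esub> w) \<otimes>\<^bsub>A\<^esub> y)) (z \<otimes>\<^bsub>A\<^esub> c))))"
  proof (rule R.sum_cong[OF T])
    fix x y z assume "x \<in> carrier A" "y \<in> carrier A" "z \<in> carrier A"
    then show "Rsum T (\<lambda>u v w. Ssum T (\<lambda>a b c.
        \<psi> ((((u \<otimes>\<^bsub>A\<^esub> x) \<otimes>\<^bsub>A\<^esub> a) \<otimes>\<^bsub>A\<^esub> (v \<otimes>\<^bsub>A\<^esub> b)) \<otimes>\<^bsub>A\<^esub> (w \<otimes>\<^bsub>A\<^esub> y)) (z \<otimes>\<^bsub>A\<^esub> c))) =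
      Rsum T (\<lambda>u v w. Ssum T (\<lambda>a b c.
        \<psi> (((u \<otimes>\<^bsub>A\<^esub> a) \<otimes>\<^bsub>A\<^esub> (v \<otimes>\<^bsub>A\<^esub> b)) \<otimes>\<^bsub>A\<^esub> ((x \<otimes>\<^bsub>A\<^esub> w) \<otimes>\<^bsub>A\<^esub> y)) (z \<otimes>\<^bsub>A\<^esub> c)))"
      by (intro R_third_first[OF T, of "\<lambda>u v w. Ssum T (\<lambda>a b c.
          \<psi> (((u \<otimes>\<^bsub>A\<^esub> a) \<otimes>\<^bsub>A\<^esub> (v \<otimes>\<^bsub>A\<^esub> b)) \<otimes>\<^bsub>A\<^esub> (w \<otimes>\<^bsub>A\<^esub> y)) (z \<otimes>\<^bsub>A\<^esub> c))", symmetric])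
        (auto intro!: trilinearI homs)
  qed (auto intro!: closed)
  also have "\<dots> = Rsum T (\<lambda>x y z. Rsum T (\<lambda>u v w. Ssum T (\<lambda>a b c.
      \<psi> (((u \<otimes>\<^bsub>A\<^esub> a) \<otimes>\<^bsub>A\<^esub> (v \<otimes>\<^bsub>A\<^esub> b)) \<otimes>\<^bsub>A\<^esub> (x \<otimes>\<^bsub>A\<^esub> (w \<otimes>\<^bsub>A\<^esub> y))) (z \<otimes>\<^bsub>A\<^esub> c))))"
    by (intro cong closed) (simp_all add: A.m_assoc)
  also have "\<dots> = Rsum T (\<lambda>u v w. Rsum T (\<lambda>x y z. Ssum T (\<lambda>a b c.
      \<psi> (((u \<otimes>\<^bsub>A\<^esub> a) \<otimes>\<^bsub>A\<^esub> (v \<otimes>\<^bsub>A\<^esub> b)) \<otimes>\<^bsub>A\<^esub> (x \<otimes>\<^bsub>A\<^esub> (w \<otimes>\<^bsub>A\<^esub> y))) (z \<otimes>\<^bsub>A\<^esub> c))))"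
    by (rule sum3_swap[OF R_sum R_sum T]) (auto intro!: closed)
  also have "\<dots> = Rsum T (\<lambda>u v w. Rsum T (\<lambda>x y z. Ssum T (\<lambda>a b c.
      \<psi> (((u \<otimes>\<^bsub>A\<^esub> a) \<otimes>\<^bsub>A\<^esub> (v \<otimes>\<^bsub>A\<^esub> b)) \<otimes>\<^bsub>A\<^esub> (x \<otimes>\<^bsub>A\<^esub> y)) ((z \<otimes>\<^bsub>A\<^esub> w) \<otimes>\<^bsub>A\<^esub> c))))"
  proof (rule R.sum_cong[OF T])
    fix u v w assume "u \<in> carrier A" "v \<in> carrier A" "w \<in> carrier A"
    then show "Rsum T (\<lambda>x y z. Ssum T (\<lambda>a b c.
        \<psi> (((u \<otimes>\<^bsub>A\<^esub> a) \<otimes>\<^bsub>A\<^esub> (v \<otimes>\<^bsub>A\<^esub> b)) \<otimes>\<^bsub>A\<^esub> (x \<otimes>\<^bsub>A\<^esub> (w \<otimes>\<^bsub>A\<^esub> y))) (z \<otimes>\<^bsub>A\<^esub> c))) =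
      Rsum T (\<lambda>x y z. Ssum T (\<lambda>a b c.
        \<psi> (((u \<otimes>\<^bsub>A\<^esub> a) \<otimes>\<^bsub>A\<^esub> (v \<otimes>\<^bsub>A\<^esub> b)) \<otimes>\<^bsub>A\<^esub> (x \<otimes>\<^bsub>A\<^esub> y)) ((z \<otimes>\<^bsub>A\<^esub> w) \<otimes>\<^bsub>A\<^esub> c)))"
      by (intro R_second_third[OF T, of "\<lambda>x y z. Ssum T (\<lambda>a b c.
          \<psi> (((u \<otimes>\<^bsub>A\<^esub> a) \<otimes>\<^bsub>A\<^esub> (v \<otimes>\<^bsub>A\<^esub> b)) \<otimes>\<^bsub>A\<^esub> (x \<otimes>\<^bsub>A\<^esub> y)) (z \<otimes>\<^bsub>A\<^esub> c))"])
        (auto intro!: trilinearI homs)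
  qed (auto intro!: closed)
  also have "\<dots> = Rsum T (\<lambda>u v w. Rsum T (\<lambda>x y z. Ssum T (\<lambda>a b c.
      \<psi> (((u \<otimes>\<^bsub>A\<^esub> a) \<otimes>\<^bsub>A\<^esub> (v \<otimes>\<^bsub>A\<^esub> b)) \<otimes>\<^bsub>A\<^esub> (x \<otimes>\<^bsub>A\<^esub> y)) (z \<otimes>\<^bsub>A\<^esub> (w \<otimes>\<^bsub>A\<^esub> c)))))"
    by (intro cong closed) (simp_all add: A.m_assoc)
  also have "\<dots> = Rsum T (\<lambda>x y z. Rsum T (\<lambda>u v w. Ssum T (\<lambda>a b c.
      \<psi> (((u \<otimes>\<^bsub>A\<^esub> a) \<otimes>\<^bsub>A\<^esub> (v \<otimes>\<^bsub>A\<^esub> b)) \<otimes>\<^bsub>A\<^esub> (x \<otimes>\<^bsub>A\<^esub> y)) (z \<otimes>\<^bsub>A\<^esub> (w \<otimes>\<^bsub>A\<^esub> c)))))"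
    by (rule sum3_swap[OF R_sum R_sum T]) (auto intro!: closed)
  also have "\<dots> = Rsum T (\<lambda>x y z. \<psi> (x \<otimes>\<^bsub>A\<^esub> y) z)"
  proof (rule R.sum_cong[OF T])
    fix x y z assume "x \<in> carrier A" "y \<in> carrier A" "z \<in> carrier A"
    then show "Rsum T (\<lambda>u v w. Ssum T (\<lambda>a b c.
        \<psi> (((u \<otimes>\<^bsub>A\<^esub> a) \<otimes>\<^bsub>A\<^esub> (v \<otimes>\<^bsub>A\<^esub> b)) \<otimes>\<^bsub>A\<^esub> (x \<otimes>\<^bsub>A\<^esub> y)) (z \<otimes>\<^bsub>A\<^esub> (w \<otimes>\<^bsub>A\<^esub> c)))) =
      \<psi> (x \<otimes>\<^bsub>A\<^esub> y) z"
      by (subst R_times_S[OF T, of "\<lambda>u v w. \<psi> ((u \<otimes>\<^bsub>A\<^esub> v) \<otimes>\<^bsub>A\<^esub> (x \<otimes>\<^bsub>A\<^esub> y)) (z \<otimes>\<^bsub>A\<^esub> w)"])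
        (auto intro!: trilinearI homs)
  qed (auto intro!: closed)
  finally show ?thesis ..
qed

text \<open>
  The same argument as before with the fifth axiom, which the third and second
  axioms turn into \<open>R\<^sup>1 \<otimes> 1 \<otimes> R\<^sup>2 \<otimes> R\<^sup>3 = R\<^sup>1 \<otimes> r\<^sup>3r\<^sup>1 \<otimes> r\<^sup>2R\<^sup>2 \<otimes> R\<^sup>3\<close>; now \<open>R\<close> is cancelled against \<open>S\<close>
  in the tensor factors 1, 3 and 4. Again \<open>(x, y, z)\<close> stands for \<open>R\<close> and \<open>(u, v, w)\<close> for \<open>r\<close>.
\<close>

lemma R_third_times_first:
  assumes T: "module k T" and \<psi>: "bilinear k A A T \<psi>"
  shows "Rsum T (\<lambda>x y z. \<psi> (z \<otimes>\<^bsub>A\<^esub> x) y) = \<psi> \<one>\<^bsub>A\<^esub> \<one>\<^bsub>A\<^esub>"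
proof -
  note homs = hom_intros bilinear_hom[OF \<psi>] S.sum_linear[OF module_A T]
  note closed = bilinear_closed[OF \<psi>] R.sum_closed[OF T] S.sum_closed[OF T]
  note cong = R.sum_cong[OF T] S.sum_cong[OF T]
  have "\<psi> \<one>\<^bsub>A\<^esub> \<one>\<^bsub>A\<^esub> = Rsum T (\<lambda>x y z. Ssum T (\<lambda>a b c.
      \<psi> (((x \<otimes>\<^bsub>A\<^esub> a) \<otimes>\<^bsub>A\<^esub> (z \<otimes>\<^bsub>A\<^esub> c)) \<otimes>\<^bsub>A\<^esub> \<one>\<^bsub>A\<^esub>) (y \<otimes>\<^bsub>A\<^esub> b)))"
    by (subst R_times_S[OF T, of "\<lambda>x y z. \<psi> ((x \<otimes>\<^bsub>A\<^esub> z) \<otimes>\<^bsub>A\<^esub> \<one>\<^bsub>A\<^esub>) y"])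
      (auto intro!: trilinearI homs)
  also have "\<dots> = Rsum T (\<lambda>u v w. Rsum T (\<lambda>x y z. Ssum T (\<lambda>a b c.
      \<psi> (((x \<otimes>\<^bsub>A\<^esub> a) \<otimes>\<^bsub>A\<^esub> ((z \<otimes>\<^bsub>A\<^esub> w) \<otimes>\<^bsub>A\<^esub> c)) \<otimes>\<^bsub>A\<^esub> (y \<otimes>\<^bsub>A\<^esub> u)) (v \<otimes>\<^bsub>A\<^esub> b))))"
    by (rule R_insert_second[OF T, of "\<lambda>x y z w. Ssum T (\<lambda>a b c.
        \<psi> (((x \<otimes>\<^bsub>A\<^esub> a) \<otimes>\<^bsub>A\<^esub> (w \<otimes>\<^bsub>A\<^esub> c)) \<otimes>\<^bsub>A\<^esub> y) (z \<otimes>\<^bsub>A\<^esub> b))"])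
      (auto intro!: quadrilinearI homs)
  also have "\<dots> = Rsum T (\<lambda>u v w. Rsum T (\<lambda>x y z. Ssum T (\<lambda>a b c.
      \<psi> (((x \<otimes>\<^bsub>A\<^esub> a) \<otimes>\<^bsub>A\<^esub> (z \<otimes>\<^bsub>A\<^esub> c)) \<otimes>\<^bsub>A\<^esub> ((w \<otimes>\<^bsub>A\<^esub> y) \<otimes>\<^bsub>A\<^esub> u)) (v \<otimes>\<^bsub>A\<^esub> b))))"
  proof (rule R.sum_cong[OF T])
    fix u v w assume "u \<in> carrier A" "v \<in> carrier A" "w \<in> carrier A"
    then show "Rsum T (\<lambda>x y z. Ssum T (\<lambda>a b c.
        \<psi> (((x \<otimes>\<^bsub>A\<^esub> a) \<otimes>\<^bsub>A\<^esub> ((z \<otimes>\<^bsub>A\<^esub> w) \<otimes>\<^bsub>A\<^esub> c)) \<otimes>\<^bsub>A\<^esub> (y \<otimes>\<^bsub>A\<^esub> u)) (v \<otimes>\<^bsub>A\<^esub> b))) =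
      Rsum T (\<lambda>x y z. Ssum T (\<lambda>a b c.
        \<psi> (((x \<otimes>\<^bsub>A\<^esub> a) \<otimes>\<^bsub>A\<^esub> (z \<otimes>\<^bsub>A\<^esub> c)) \<otimes>\<^bsub>A\<^esub> ((w \<otimes>\<^bsub>A\<^esub> y) \<otimes>\<^bsub>A\<^esub> u)) (v \<otimes>\<^bsub>A\<^esub> b)))"
      by (intro R_second_third[OF T, of "\<lambda>x y z. Ssum T (\<lambda>a b c.
          \<psi> (((x \<otimes>\<^bsub>A\<^esub> a) \<otimes>\<^bsub>A\<^esub> (z \<otimes>\<^bsub>A\<^esub> c)) \<otimes>\<^bsub>A\<^esub> (y \<otimes>\<^bsub>A\<^esub> u)) (v \<otimes>\<^bsub>A\<^esub> b))", symmetric])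
        (auto intro!: trilinearI homs)
  qed (auto intro!: closed)
  also have "\<dots> = Rsum T (\<lambda>u v w. Rsum T (\<lambda>x y z. Ssum T (\<lambda>a b c.
      \<psi> (((x \<otimes>\<^bsub>A\<^esub> a) \<otimes>\<^bsub>A\<^esub> (z \<otimes>\<^bsub>A\<^esub> c)) \<otimes>\<^bsub>A\<^esub> (w \<otimes>\<^bsub>A\<^esub> (y \<otimes>\<^bsub>A\<^esub> u))) (v \<otimes>\<^bsub>A\<^esub> b))))"
    by (intro cong closed) (simp_all add: A.m_assoc)
  also have "\<dots> = Rsum T (\<lambda>x y z. Rsum T (\<lambda>u v w. Ssum T (\<lambda>a b c.
      \<psi> (((x \<otimes>\<^bsub>A\<^esub> a) \<otimes>\<^bsub>A\<^esub> (z \<otimes>\<^bsub>A\<^esub> c)) \<otimes>\<^bsub>A\<^esub> (w \<otimes>\<^bsub>A\<^esub> (y \<otimes>\<^bsub>A\<^esub> u))) (v \<otimes>\<^bsub>A\<^esub> b))))"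
    by (rule sum3_swap[OF R_sum R_sum T]) (auto intro!: closed)
  also have "\<dots> = Rsum T (\<lambda>x y z. Rsum T (\<lambda>u v w. Ssum T (\<lambda>a b c.
      \<psi> (((x \<otimes>\<^bsub>A\<^esub> a) \<otimes>\<^bsub>A\<^esub> (z \<otimes>\<^bsub>A\<^esub> c)) \<otimes>\<^bsub>A\<^esub> (w \<otimes>\<^bsub>A\<^esub> u)) ((v \<otimes>\<^bsub>A\<^esub> y) \<otimes>\<^bsub>A\<^esub> b))))"
  proof (rule R.sum_cong[OF T])
    fix x y z assume "x \<in> carrier A" "y \<in> carrier A" "z \<in> carrier A"
    then show "Rsum T (\<lambda>u v w. Ssum T (\<lambda>a b c.
        \<psi> (((x \<otimes>\<^bsub>A\<^esub> a) \<otimes>\<^bsub>A\<^esub> (z \<otimes>\<^bsub>A\<^esub> c)) \<otimes>\<^bsub>A\<^esub> (w \<otimes>\<^bsub>A\<^esub> (y \<otimes>\<^bsub>A\<^esub> u))) (v \<otimes>\<^bsub>A\<^esub> b))) =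
      Rsum T (\<lambda>u v w. Ssum T (\<lambda>a b c.
        \<psi> (((x \<otimes>\<^bsub>A\<^esub> a) \<otimes>\<^bsub>A\<^esub> (z \<otimes>\<^bsub>A\<^esub> c)) \<otimes>\<^bsub>A\<^esub> (w \<otimes>\<^bsub>A\<^esub> u)) ((v \<otimes>\<^bsub>A\<^esub> y) \<otimes>\<^bsub>A\<^esub> b)))"
      by (intro R_first_second[OF T, of "\<lambda>u v w. Ssum T (\<lambda>a b c.
          \<psi> (((x \<otimes>\<^bsub>A\<^esub> a) \<otimes>\<^bsub>A\<^esub> (z \<otimes>\<^bsub>A\<^esub> c)) \<otimes>\<^bsub>A\<^esub> (w \<otimes>\<^bsub>A\<^esub> u)) (v \<otimes>\<^bsub>A\<^esub> b))"])
        (auto intro!: trilinearI homs)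
  qed (auto intro!: closed)
  also have "\<dots> = Rsum T (\<lambda>x y z. Rsum T (\<lambda>u v w. Ssum T (\<lambda>a b c.
      \<psi> (((x \<otimes>\<^bsub>A\<^esub> a) \<otimes>\<^bsub>A\<^esub> (z \<otimes>\<^bsub>A\<^esub> c)) \<otimes>\<^bsub>A\<^esub> (w \<otimes>\<^bsub>A\<^esub> u)) (v \<otimes>\<^bsub>A\<^esub> (y \<otimes>\<^bsub>A\<^esub> b)))))"
    by (intro cong closed) (simp_all add: A.m_assoc)
  also have "\<dots> = Rsum T (\<lambda>u v w. Rsum T (\<lambda>x y z. Ssum T (\<lambda>a b c.
      \<psi> (((x \<otimes>\<^bsub>A\<^esub> a) \<otimes>\<^bsub>A\<^esub> (z \<otimes>\<^bsub>A\<^esub> c)) \<otimes>\<^bsub>A\<^esub> (w \<otimes>\<^bsub>A\<^esub> u)) (v \<otimes>\<^bsub>A\<^esub> (y \<otimes>\<^bsub>A\<^esub> b)))))"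
    by (rule sum3_swap[OF R_sum R_sum T]) (auto intro!: closed)
  also have "\<dots> = Rsum T (\<lambda>u v w. \<psi> (w \<otimes>\<^bsub>A\<^esub> u) v)"
  proof (rule R.sum_cong[OF T])
    fix u v w assume "u \<in> carrier A" "v \<in> carrier A" "w \<in> carrier A"
    then show "Rsum T (\<lambda>x y z. Ssum T (\<lambda>a b c.
        \<psi> (((x \<otimes>\<^bsub>A\<^esub> a) \<otimes>\<^bsub>A\<^esub> (z \<otimes>\<^bsub>A\<^esub> c)) \<otimes>\<^bsub>A\<^esub> (w \<otimes>\<^bsub>A\<^esub> u)) (v \<otimes>\<^bsub>A\<^esub> (y \<otimes>\<^bsub>A\<^esub> b)))) =
      \<psi> (w \<otimes>\<^bsub>A\<^esub> u) v"
      by (subst R_times_S[OF T, of "\<lambda>x y z. \<psi> ((x \<otimes>\<^bsub>A\<^esub> z) \<otimes>\<^bsub>A\<^esub> (w \<otimes>\<^bsub>A\<^esub> u)) (v \<otimes>\<^bsub>A\<^esub> y)"])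
        (auto intro!: trilinearI homs)
  qed (auto intro!: closed)
  finally show ?thesis ..
qed

text \<open>
  The element \<open>a\<close> leaves the product by the third axiom and the contraction does the rest.
\<close>

lemma R_conjugate_scalar:
  assumes T: "module k T" and \<psi>: "bilinear k A A T \<psi>" and a: "a \<in> carrier A"
  shows "Rsum T (\<lambda>x y z. \<psi> (x \<otimes>\<^bsub>A\<^esub> (a \<otimes>\<^bsub>A\<^esub> y)) z) = \<psi> \<one>\<^bsub>A\<^esub> a"
proof -
  have "Rsum T (\<lambda>x y z. \<psi> (x \<otimes>\<^bsub>A\<^esub> (a \<otimes>\<^bsub>A\<^esub> y)) z) = Rsum T (\<lambda>x y z. \<psi> (x \<otimes>\<^bsub>A\<^esub> y) (z \<otimes>\<^bsub>A\<^esub> a))"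
    by (rule R_second_third[OF T, of "\<lambda>x y z. \<psi> (x \<otimes>\<^bsub>A\<^esub> y) z"])
      (auto intro!: trilinearI hom_intros bilinear_hom[OF \<psi>] a)
  also have "\<dots> = \<psi> \<one>\<^bsub>A\<^esub> (\<one>\<^bsub>A\<^esub> \<otimes>\<^bsub>A\<^esub> a)"
    by (rule R_first_times_second[OF T, of "\<lambda>x y. \<psi> x (y \<otimes>\<^bsub>A\<^esub> a)"])
      (auto intro!: bilinearI hom_intros bilinear_hom[OF \<psi>] a)
  finally show ?thesis using a by simp
qed

end

section \<open>Absorption of R in a bimodule\<close>

locale canonical_R_bimodule = canonical_R k A I p R J q S + bimodule k A V l r
  for k :: "('k, 'x) ring_scheme" and A :: "('k, 'a, 'y) module_scheme"
    and I :: "'i set" and p :: "'i \<Rightarrow> 'a list" and R :: "('a list \<Rightarrow> 'k) set"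
    and J :: "'j set" and q :: "'j \<Rightarrow> 'a list" and S :: "('a list \<Rightarrow> 'k) set"
    and V :: "('k, 'v, 'z) module_scheme" and l :: "'a \<Rightarrow> 'v \<Rightarrow> 'v" and r :: "'v \<Rightarrow> 'a \<Rightarrow> 'v"
begin

lemmas action_simps = l_closed r_closed l_assoc r_assoc l_r_assoc

text \<open>
  The axioms of a bimodule relate the scalars of \<open>k\<close> to the actions only through the multiples of
  the unit of \<open>A\<close>; the compatibility of each action with scalars in both arguments follows.
\<close>

lemma l_smult_left:
  assumes "c \<in> carrier k" "a \<in> carrier A" "v \<in> carrier V"
  shows "l (c \<odot>\<^bsub>A\<^esub> a) v = c \<odot>\<^bsub>V\<^esub> l a v"
proof -
  have "c \<odot>\<^bsub>A\<^esub> a = (c \<odot>\<^bsub>A\<^esub> \<one>\<^bsub>A\<^esub>) \<otimes>\<^bsub>A\<^esub> a" using assms by (simp flip: A.smult_mult_left)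
  then show ?thesis using assms by (simp add: l_assoc l_central l_closed)
qed

lemma l_smult_right:
  assumes "c \<in> carrier k" "a \<in> carrier A" "v \<in> carrier V"
  shows "l a (c \<odot>\<^bsub>V\<^esub> v) = c \<odot>\<^bsub>V\<^esub> l a v"
proof -
  have "l a (c \<odot>\<^bsub>V\<^esub> v) = l (a \<otimes>\<^bsub>A\<^esub> (c \<odot>\<^bsub>A\<^esub> \<one>\<^bsub>A\<^esub>)) v"
    using assms by (simp add: l_assoc l_central)
  also have "a \<otimes>\<^bsub>A\<^esub> (c \<odot>\<^bsub>A\<^esub> \<one>\<^bsub>A\<^esub>) = c \<odot>\<^bsub>A\<^esub> a" using assms by (simp flip: A.smult_mult_right)
  finally show ?thesis using assms by (simp add: l_smult_left)
qed

lemma r_smult_left: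
  assumes "c \<in> carrier k" "a \<in> carrier A" "v \<in> carrier V"
  shows "r (c \<odot>\<^bsub>V\<^esub> v) a = c \<odot>\<^bsub>V\<^esub> r v a"
proof -
  have "r (c \<odot>\<^bsub>V\<^esub> v) a = r v ((c \<odot>\<^bsub>A\<^esub> \<one>\<^bsub>A\<^esub>) \<otimes>\<^bsub>A\<^esub> a)"
    using assms by (simp add: r_assoc r_central)
  also have "(c \<odot>\<^bsub>A\<^esub> \<one>\<^bsub>A\<^esub>) \<otimes>\<^bsub>A\<^esub> a = a \<otimes>\<^bsub>A\<^esub> (c \<odot>\<^bsub>A\<^esub> \<one>\<^bsub>A\<^esub>)"
    using assms by (simp flip: A.smult_mult_left A.smult_mult_right)
  finally show ?thesis using assms by (simp add: r_assoc r_central r_closed)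
qed

lemma r_smult_right:
  assumes "c \<in> carrier k" "a \<in> carrier A" "v \<in> carrier V"
  shows "r v (c \<odot>\<^bsub>A\<^esub> a) = c \<odot>\<^bsub>V\<^esub> r v a"
proof -
  have "c \<odot>\<^bsub>A\<^esub> a = (c \<odot>\<^bsub>A\<^esub> \<one>\<^bsub>A\<^esub>) \<otimes>\<^bsub>A\<^esub> a" using assms by (simp flip: A.smult_mult_left)
  then show ?thesis using assms by (simp add: r_assoc r_central r_smult_left)
qed

lemma action_hom:
  shows "\<lbrakk>g \<in> module_hom k L A; v \<in> carrier V\<rbrakk> \<Longrightarrow> (\<lambda>s. l (g s) v) \<in> module_hom k L V"
    and "\<lbrakk>a \<in> carrier A; h \<in> module_hom k L V\<rbrakk> \<Longrightarrow> (\<lambda>s. l a (h s)) \<in> module_hom k L V"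
    and "\<lbrakk>g \<in> module_hom k L A; v \<in> carrier V\<rbrakk> \<Longrightarrow> (\<lambda>s. r v (g s)) \<in> module_hom k L V"
    and "\<lbrakk>a \<in> carrier A; h \<in> module_hom k L V\<rbrakk> \<Longrightarrow> (\<lambda>s. r (h s) a) \<in> module_hom k L V"
  by (auto simp: module_hom_def Pi_def l_closed r_closed l_add_scalar l_add r_add_scalar r_add
      l_smult_left l_smult_right r_smult_left r_smult_right)

text \<open>
  The second axiom says that \<open>R\<^sup>1 w R\<^sup>2 \<otimes> R\<^sup>3\<close> commutes with \<open>A\<close> in its first factor. So in
  \<open>s\<^sup>1 a R\<^sup>1 w R\<^sup>2 s\<^sup>2 \<otimes> s\<^sup>3 \<otimes> R\<^sup>3\<close>, where \<open>s\<close> is a second copy of \<open>R\<close>, the product \<open>s\<^sup>1 a\<close> can be moved to the right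
  of \<open>R\<^sup>1 w R\<^sup>2\<close>, where \<open>s\<^sup>1 a s\<^sup>2 \<otimes> s\<^sup>3 = 1 \<otimes> a\<close> appears. This removes one of the three copies of \<open>R\<close> from each triple
  composition of legs.
\<close>

lemma R_absorb:
  assumes T: "module k T" and \<phi>: "trilinear k V A A T \<phi>" and a: "a \<in> carrier A" and w: "w \<in> carrier V"
  shows "Rsum T (\<lambda>x y z. Rsum T (\<lambda>s t u. \<phi> (l s (l a (l x (r (r w y) t)))) u z)) =
    Rsum T (\<lambda>x y z. \<phi> (l x (r w y)) a z)"
proof -
  note homs = hom_intros action_hom trilinear_hom[OF \<phi>]
  note closed = trilinear_closed[OF \<phi>] R.sum_closed[OF T] l_closed r_closed a w
  have "Rsum T (\<lambda>x y z. Rsum T (\<lambda>s t u. \<phi> (l s (l a (l x (r (r w y) t)))) u z)) =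
    Rsum T (\<lambda>s t u. Rsum T (\<lambda>x y z. \<phi> (l s (l a (l x (r (r w y) t)))) u z))"
    by (rule sum3_swap[OF R_sum R_sum T]) (auto intro!: closed)
  also have "\<dots> = Rsum T (\<lambda>s t u. Rsum T (\<lambda>x y z. \<phi> (l ((s \<otimes>\<^bsub>A\<^esub> a) \<otimes>\<^bsub>A\<^esub> x) (r (r w y) t)) u z))"
    by (intro R.sum_cong[OF T] closed) (simp_all add: action_simps a w)
  also have "\<dots> = Rsum T (\<lambda>s t u. Rsum T (\<lambda>x y z. \<phi> (l x (r (r w (y \<otimes>\<^bsub>A\<^esub> (s \<otimes>\<^bsub>A\<^esub> a))) t)) u z))"
  proof (rule R.sum_cong[OF T])
    fix s t u assume "s \<in> carrier A" "t \<in> carrier A" "u \<in> carrier A"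
    then show "Rsum T (\<lambda>x y z. \<phi> (l ((s \<otimes>\<^bsub>A\<^esub> a) \<otimes>\<^bsub>A\<^esub> x) (r (r w y) t)) u z) =
        Rsum T (\<lambda>x y z. \<phi> (l x (r (r w (y \<otimes>\<^bsub>A\<^esub> (s \<otimes>\<^bsub>A\<^esub> a))) t)) u z)"
      by (intro R_first_second[OF T, of "\<lambda>x y z. \<phi> (l x (r (r w y) t)) u z"])
        (auto intro!: trilinearI homs closed)
  qed (auto intro!: closed)
  also have "\<dots> = Rsum T (\<lambda>s t u. Rsum T (\<lambda>x y z. \<phi> (l x (r (r w y) (s \<otimes>\<^bsub>A\<^esub> (a \<otimes>\<^bsub>A\<^esub> t)))) u z))"
    by (intro R.sum_cong[OF T] closed) (simp_all add: action_simps a w)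
  also have "\<dots> = Rsum T (\<lambda>x y z. Rsum T (\<lambda>s t u. \<phi> (l x (r (r w y) (s \<otimes>\<^bsub>A\<^esub> (a \<otimes>\<^bsub>A\<^esub> t)))) u z))"
    by (rule sum3_swap[OF R_sum R_sum T]) (auto intro!: closed)
  also have "\<dots> = Rsum T (\<lambda>x y z. \<phi> (l x (r w y)) a z)"
  proof (rule R.sum_cong[OF T])
    fix x y z assume "x \<in> carrier A" "y \<in> carrier A" "z \<in> carrier A"
    then show "Rsum T (\<lambda>s t u. \<phi> (l x (r (r w y) (s \<otimes>\<^bsub>A\<^esub> (a \<otimes>\<^bsub>A\<^esub> t)))) u z) = \<phi> (l x (r w y)) a z"
      by (subst R_conjugate_scalar[OF T, of "\<lambda>b c. \<phi> (l x (r (r w y) b)) c z"])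
        (auto intro!: bilinearI homs closed simp: r_one r_closed w)
  qed (auto intro!: closed)
  finally show ?thesis .
qed

section \<open>The map Omega and its legs\<close>

abbreviation "V2 \<equiv> tensor_power k V 2"
abbreviation "V3 \<equiv> tensor_power k V 3"
abbreviation "\<Omega> \<equiv> Omega k V l r R"

lemma module_V: "module k V" by (rule V.module_axioms)
lemma module_V2: "module k V2" by (rule module_tensor_power[OF module_V])
lemma module_V3: "module k V3" by (rule module_tensor_power[OF module_V])

lemmas V_homs = hom_intros action_hom tensor2_hom[OF module_V] tensor3_hom[OF module_V]
  R.sum_linear[OF module_V module_V2] R.sum_linear[OF module_V module_V3]

lemma tensor_V_closed:
  "\<lbrakk>u \<in> carrier V; v \<in> carrier V\<rbrakk> \<Longrightarrow> tensor k V [u, v] \<in> carrier V2"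
  "\<lbrakk>u \<in> carrier V; v \<in> carrier V; w \<in> carrier V\<rbrakk> \<Longrightarrow> tensor k V [u, v, w] \<in> carrier V3"
  by (auto intro!: tensor_closed module_V simp: tuples_def)

lemmas V_closed = tensor_V_closed l_closed r_closed R.sum_closed[OF module_V2] R.sum_closed[OF module_V3]

text \<open>
  From here on values of \<open>\<Omega>\<close> are written with the left actions outside and the right actions inside,
  the form into which \<open>action_simps\<close> rewrites.
\<close>

lemma Omega_bilinear:
  "bilinear k V V V2 (\<lambda>v w. Rsum V2 (\<lambda>x y z. tensor k V [l x (r w y), l z v]))"
  by (auto intro!: bilinearI V_homs V_closed)

lemma Omega_summand:
  assumes "v \<in> carrier V" "w \<in> carrier V"
  shows "sweedler3 k V2 (\<lambda>x y z. tensor k V [r (l x w) y, l z v]) R =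
    Rsum V2 (\<lambda>x y z. tensor k V [l x (r w y), l z v])"
proof -
  have "trilinear k A A A V2 (\<lambda>x y z. tensor k V [r (l x w) y, l z v])"
    using assms by (auto intro!: trilinearI V_homs V_closed)
  from R.sweedler3_eq_sum[OF module_V2 this]
  show ?thesis using assms by (auto intro!: R.sum_cong[OF module_V2] V_closed simp: l_r_assoc)
qed

lemma Omega_multilinear:
  "multilinear k V V2 2 (\<lambda>xs. sweedler3 k V2 (\<lambda>x y z. tensor k V [r (l x (xs ! 1)) y, l z (xs ! 0)]) R)"
  by (rule bilinear_multilinear[of k V V2 "\<lambda>v w. sweedler3 k V2 (\<lambda>x y z. tensor k V [r (l x w) y, l z v]) R"],
      rule bilinear_cong[OF Omega_bilinear module_V module_V]) (simp add: Omega_summand)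

lemma Omega_hom: "\<Omega> \<in> module_hom k V2 V2"
  unfolding Omega_def sweedler2_def
  by (rule tensor_lift_hom[OF module_V module_V2 Omega_multilinear])

lemma Omega_tensor:
  assumes "v \<in> carrier V" "w \<in> carrier V"
  shows "\<Omega> (tensor k V [v, w]) = Rsum V2 (\<lambda>x y z. tensor k V [l x (r w y), l z v])"
  unfolding Omega_def sweedler2_def using assms
  by (subst tensor_lift_tensor[OF module_V module_V2 Omega_multilinear]) (auto simp: tuples_def Omega_summand)

text \<open>
  The positions \<open>i - 1\<close> and \<open>j - 1\<close> are kept as variables so that the well-definedness of the inner and
  of the outer lift is proved once for the three legs. The trilinear \<open>g\<close> is the closed form of the leg
  on pure tensors.
\<close>

lemma leg_Omega:
  assumes ij: "i - 1 < 3" "j - 1 < 3" "i - 1 \<noteq> j - 1"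
    and g: "trilinear k V V V V3 g"
    and eq: "\<And>u v w. \<lbrakk>u \<in> carrier V; v \<in> carrier V; w \<in> carrier V\<rbrakk> \<Longrightarrow>
      g u v w = Rsum V3 (\<lambda>x y z. tensor k V ([u, v, w]
        [i - 1 := l x (r ([u, v, w] ! (j - 1)) y), j - 1 := l z ([u, v, w] ! (i - 1))]))"
  shows "leg k V i j \<Omega> \<in> module_hom k V3 V3"
    and "\<lbrakk>u \<in> carrier V; v \<in> carrier V; w \<in> carrier V\<rbrakk> \<Longrightarrow> leg k V i j \<Omega> (tensor k V [u, v, w]) = g u v w"
proof -
  define G where "G us = sweedler2 k V3 (\<lambda>x y. tensor k V (us[i - 1 := x, j - 1 := y]))
    (\<Omega> (tensor k V [us ! (i - 1), us ! (j - 1)]))" for us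
  have G: "G us = g (us ! 0) (us ! 1) (us ! 2)" if us: "us \<in> tuples V 3" for us
  proof -
    let ?f = "\<lambda>x y. tensor k V (us[i - 1 := x, j - 1 := y])"
    have bil: "bilinear k V V V3 ?f"
    proof (rule bilinearI)
      show "(\<lambda>x. ?f x y) \<in> module_hom k V V3" if "y \<in> carrier V" for y
        unfolding list_update_swap[OF ij(3)]
        by (rule tensor_hom_update[OF module_V tuples_update[OF us that] ij(1) module_hom_id])
      show "(\<lambda>y. ?f x y) \<in> module_hom k V V3" if "x \<in> carrier V" for x
        by (rule tensor_hom_update[OF module_V tuples_update[OF us that] ij(2) module_hom_id])
    qed
    have L: "sweedler2 k V3 ?f \<in> module_hom k V2 V3"
      unfolding sweedler2_def
      by (rule tensor_lift_hom[OF module_V module_V3 bilinear_multilinear[OF bil]])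
    have Lt: "sweedler2 k V3 ?f (tensor k V [x, y]) = ?f x y" if "x \<in> carrier V" "y \<in> carrier V" for x y
      unfolding sweedler2_def using that
      by (subst tensor_lift_tensor[OF module_V module_V3 bilinear_multilinear[OF bil]])
        (auto simp: tuples_def)
    have c: "us ! (i - 1) \<in> carrier V" "us ! (j - 1) \<in> carrier V"
      using us ij by (auto intro: tuples_nth)
    have "G us = sweedler2 k V3 ?f (Rsum V2 (\<lambda>x y z. tensor k V [l x (r (us ! (j - 1)) y), l z (us ! (i - 1))]))"
      unfolding G_def Omega_tensor[OF c] ..
    also have "\<dots> = Rsum V3 (\<lambda>x y z. sweedler2 k V3 ?f (tensor k V [l x (r (us ! (j - 1)) y), l z (us ! (i - 1))]))"
      by (rule R.hom_of_sum[OF L module_V2 module_V3]) (intro V_closed c; assumption)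
    also have "\<dots> = Rsum V3 (\<lambda>x y z. ?f (l x (r (us ! (j - 1)) y)) (l z (us ! (i - 1))))"
      by (intro R.sum_cong[OF module_V3] Lt V_closed c bilinear_closed[OF bil])
    also have "\<dots> = g (us ! 0) (us ! 1) (us ! 2)"
      by (rule eq[of "us ! 0" "us ! 1" "us ! 2", folded tuples3_eq[OF us], symmetric])
        (auto intro: tuples_nth[OF us])
    finally show ?thesis .
  qed
  have m: "multilinear k V V3 3 G"
    by (rule multilinear_cong[OF trilinear_multilinear[OF g] module_V]) (simp add: G)
  have leg: "leg k V i j \<Omega> = tensor_lift k V3 G"
    by (simp add: leg_def G_def[abs_def])
  show "leg k V i j \<Omega> \<in> module_hom k V3 V3"
    unfolding leg by (rule tensor_lift_hom[OF module_V module_V3 m])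
  show "leg k V i j \<Omega> (tensor k V [u, v, w]) = g u v w"
    if "u \<in> carrier V" "v \<in> carrier V" "w \<in> carrier V"
    unfolding leg using that
    by (subst tensor_lift_tensor[OF module_V module_V3 m]) (auto simp: tuples_def G)
qed

abbreviation "\<Omega>12 \<equiv> leg k V 1 2 \<Omega>"
abbreviation "\<Omega>13 \<equiv> leg k V 1 3 \<Omega>"
abbreviation "\<Omega>23 \<equiv> leg k V 2 3 \<Omega>"

lemma Omega12_trilinear:
  "trilinear k V V V V3 (\<lambda>u v w. Rsum V3 (\<lambda>x y z. tensor k V [l x (r v y), l z u, w]))"
  by (auto intro!: trilinearI V_homs V_closed)

lemma Omega13_trilinear:
  "trilinear k V V V V3 (\<lambda>u v w. Rsum V3 (\<lambda>x y z. tensor k V [l x (r w y), v, l z u]))"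
  by (auto intro!: trilinearI V_homs V_closed)

lemma Omega23_trilinear:
  "trilinear k V V V V3 (\<lambda>u v w. Rsum V3 (\<lambda>x y z. tensor k V [u, l x (r w y), l z v]))"
  by (auto intro!: trilinearI V_homs V_closed)

lemma Omega12_hom: "\<Omega>12 \<in> module_hom k V3 V3"
  by (rule leg_Omega(1)[OF _ _ _ Omega12_trilinear]) simp_all

lemma Omega13_hom: "\<Omega>13 \<in> module_hom k V3 V3"
  by (rule leg_Omega(1)[OF _ _ _ Omega13_trilinear]) (simp_all add: numeral_2_eq_2)

lemma Omega23_hom: "\<Omega>23 \<in> module_hom k V3 V3"
  by (rule leg_Omega(1)[OF _ _ _ Omega23_trilinear]) (simp_all add: numeral_2_eq_2)

lemma legs_tensor:
  assumes "u \<in> carrier V" "v \<in> carrier V" "w \<in> carrier V"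
  shows "\<Omega>12 (tensor k V [u, v, w]) = Rsum V3 (\<lambda>x y z. tensor k V [l x (r v y), l z u, w])"
    and "\<Omega>13 (tensor k V [u, v, w]) = Rsum V3 (\<lambda>x y z. tensor k V [l x (r w y), v, l z u])"
    and "\<Omega>23 (tensor k V [u, v, w]) = Rsum V3 (\<lambda>x y z. tensor k V [u, l x (r w y), l z v])"
  by (rule leg_Omega(2)[OF _ _ _ Omega12_trilinear] leg_Omega(2)[OF _ _ _ Omega13_trilinear]
      leg_Omega(2)[OF _ _ _ Omega23_trilinear]; simp add: assms numeral_2_eq_2)+

lemma hom_Rsum_tensor:
  assumes h: "h \<in> module_hom k (tensor_power k V n) (tensor_power k V n)"
    and f: "\<And>x y z. \<lbrakk>x \<in> carrier A; y \<in> carrier A; z \<in> carrier A\<rbrakk> \<Longrightarrow>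
      f x y z \<in> carrier (tensor_power k V n)"
    and g: "\<And>x y z. \<lbrakk>x \<in> carrier A; y \<in> carrier A; z \<in> carrier A\<rbrakk> \<Longrightarrow> h (f x y z) = g x y z"
  shows "h (Rsum (tensor_power k V n) f) = Rsum (tensor_power k V n) g"
proof -
  let ?T = "tensor_power k V n"
  have T: "module k ?T" by (rule module_tensor_power[OF module_V])
  have "h (Rsum ?T f) = Rsum ?T (\<lambda>x y z. h (f x y z))"
    by (rule R.hom_of_sum[OF h T T f])
  also have "\<dots> = Rsum ?T g"
    using g module_hom_closed[OF h f] by (intro R.sum_cong[OF T]) simp_all
  finally show ?thesis .
qed

section \<open>The Yang-Baxter equation, the braid equation and the cube\<close>

lemmas legs_sum = hom_Rsum_tensor[OF Omega12_hom] hom_Rsum_tensor[OF Omega13_hom]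
  hom_Rsum_tensor[OF Omega23_hom] hom_Rsum_tensor[OF Omega_hom]

text \<open>
  After absorption, each side of the Yang-Baxter equation and of the braid equation has one of these
  two forms, and they differ by a single use of the first axiom.
\<close>

lemma two_normal_forms_agree:
  assumes uvw: "u \<in> carrier V" "v \<in> carrier V" "w \<in> carrier V"
  shows "Rsum V3 (\<lambda>a b c. Rsum V3 (\<lambda>x y z. tensor k V [l x (r w y), l a (l z (r v b)), l c u])) =
    Rsum V3 (\<lambda>a b c. Rsum V3 (\<lambda>x y z. tensor k V [l a (r w b), l x (r v y), l c (l z u)]))"
proof -
  note cl = V_closed uvw
  have "Rsum V3 (\<lambda>a b c. Rsum V3 (\<lambda>x y z. tensor k V [l x (r w y), l a (l z (r v b)), l c u])) =
      Rsum V3 (\<lambda>x y z. Rsum V3 (\<lambda>a b c. tensor k V [l x (r w y), l a (l z (r v b)), l c u]))"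
    by (rule sum3_swap[OF R_sum R_sum module_V3]) (auto intro!: cl)
  also have "\<dots> = Rsum V3 (\<lambda>x y z. Rsum V3 (\<lambda>a b c. tensor k V [l x (r w y), l (a \<otimes>\<^bsub>A\<^esub> z) (r v b), l c u]))"
    by (intro R.sum_cong[OF module_V3] cl) (simp_all add: action_simps uvw)
  also have "\<dots> = Rsum V3 (\<lambda>x y z. Rsum V3 (\<lambda>a b c. tensor k V [l x (r w y), l a (r v b), l (z \<otimes>\<^bsub>A\<^esub> c) u]))"
  proof (rule R.sum_cong[OF module_V3])
    fix x y z assume "x \<in> carrier A" "y \<in> carrier A" "z \<in> carrier A"
    then show "Rsum V3 (\<lambda>a b c. tensor k V [l x (r w y), l (a \<otimes>\<^bsub>A\<^esub> z) (r v b), l c u]) =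
        Rsum V3 (\<lambda>a b c. tensor k V [l x (r w y), l a (r v b), l (z \<otimes>\<^bsub>A\<^esub> c) u])"
      by (intro R_third_first[OF module_V3, of "\<lambda>a b c. tensor k V [l x (r w y), l a (r v b), l c u]", symmetric])
        (auto intro!: trilinearI V_homs cl)
  qed (auto intro!: cl)
  also have "\<dots> = Rsum V3 (\<lambda>x y z. Rsum V3 (\<lambda>a b c. tensor k V [l x (r w y), l a (r v b), l z (l c u)]))"
    by (intro R.sum_cong[OF module_V3] cl) (simp_all add: action_simps uvw)
  finally show ?thesis .
qed

text \<open>
  On both sides the last leg applied acts on a factor \<open>R\<^sup>1 \<cdot> R\<^sup>2\<close> or a left multiple of one, so its copy \<open>(s, t, q)\<close> of \<open>R\<close> is absorbed:
  with \<open>a = 1\<close> on the left and with \<open>a\<close> the third component of the middle copy on the right.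
\<close>

lemma yang_baxter_tensor:
  assumes uvw: "u \<in> carrier V" "v \<in> carrier V" "w \<in> carrier V"
  shows "\<Omega>12 (\<Omega>13 (\<Omega>23 (tensor k V [u, v, w]))) = \<Omega>23 (\<Omega>13 (\<Omega>12 (tensor k V [u, v, w])))"
proof -
  note cl = V_closed uvw
  have "\<Omega>13 (\<Omega>23 (tensor k V [u, v, w])) =
      Rsum V3 (\<lambda>x y z. Rsum V3 (\<lambda>a b c. tensor k V [l a (r (l z v) b), l x (r w y), l c u]))"
    by (simp only: legs_tensor uvw) (intro legs_sum legs_tensor cl)
  then have "\<Omega>12 (\<Omega>13 (\<Omega>23 (tensor k V [u, v, w]))) =
      \<Omega>12 (Rsum V3 (\<lambda>x y z. Rsum V3 (\<lambda>a b c. tensor k V [l a (r (l z v) b), l x (r w y), l c u])))"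
    by (rule arg_cong)
  also have "\<dots> =
      Rsum V3 (\<lambda>x y z. Rsum V3 (\<lambda>a b c. Rsum V3 (\<lambda>s t q.
        tensor k V [l s (r (l x (r w y)) t), l q (l a (r (l z v) b)), l c u])))"
    by (intro legs_sum legs_tensor cl)
  also have "\<dots> = Rsum V3 (\<lambda>a b c. Rsum V3 (\<lambda>x y z. Rsum V3 (\<lambda>s t q.
        tensor k V [l s (r (l x (r w y)) t), l q (l a (r (l z v) b)), l c u])))"
    by (rule sum3_swap[OF R_sum R_sum module_V3]) (auto intro!: cl)
  also have "\<dots> = Rsum V3 (\<lambda>a b c. Rsum V3 (\<lambda>x y z. Rsum V3 (\<lambda>s t q.
        tensor k V [l s (l \<one>\<^bsub>A\<^esub> (l x (r (r w y) t))), l q (l a (l z (r v b))), l c u])))"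
    by (intro R.sum_cong[OF module_V3] cl) (simp_all add: action_simps l_one uvw)
  also have "\<dots> = Rsum V3 (\<lambda>a b c. Rsum V3 (\<lambda>x y z.
        tensor k V [l x (r w y), l \<one>\<^bsub>A\<^esub> (l a (l z (r v b))), l c u]))"
    by (intro R.sum_cong[OF module_V3]
        R_absorb[OF module_V3, of "\<lambda>m q z. tensor k V [m, l q (l a (l z (r v b))), l c u]" for a b c])
      (auto intro!: trilinearI V_homs cl)
  also have "\<dots> = Rsum V3 (\<lambda>a b c. Rsum V3 (\<lambda>x y z.
        tensor k V [l x (r w y), l a (l z (r v b)), l c u]))"
    by (intro R.sum_cong[OF module_V3] cl) (simp_all add: action_simps l_one uvw)
  also have "\<dots> = Rsum V3 (\<lambda>a b c. Rsum V3 (\<lambda>x y z. tensor k V [l a (r w b), l x (r v y), l c (l z u)]))"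
    by (rule two_normal_forms_agree[OF uvw])
  also have "\<dots> = Rsum V3 (\<lambda>a b c. Rsum V3 (\<lambda>x y z. Rsum V3 (\<lambda>s t q.
        tensor k V [l a (r w b), l s (l c (l x (r (r v y) t))), l q (l z u)])))"
    by (intro R.sum_cong[OF module_V3]
        R_absorb[OF module_V3, of "\<lambda>m q z. tensor k V [l a (r w b), m, l q (l z u)]" for a b, symmetric])
      (auto intro!: trilinearI V_homs cl)
  also have "\<dots> = Rsum V3 (\<lambda>x y z. Rsum V3 (\<lambda>a b c. Rsum V3 (\<lambda>s t q.
        tensor k V [l a (r w b), l s (l c (l x (r (r v y) t))), l q (l z u)])))"
    by (rule sum3_swap[OF R_sum R_sum module_V3]) (auto intro!: cl)
  also have "\<dots> = Rsum V3 (\<lambda>x y z. Rsum V3 (\<lambda>a b c. Rsum V3 (\<lambda>s t q.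
        tensor k V [l a (r w b), l s (r (l c (l x (r v y))) t), l q (l z u)])))"
    by (intro R.sum_cong[OF module_V3] cl) (simp_all add: action_simps uvw)
  also have "\<dots> = \<Omega>23 (Rsum V3 (\<lambda>x y z. Rsum V3 (\<lambda>a b c. tensor k V [l a (r w b), l z u, l c (l x (r v y))])))"
    by (rule sym) (intro legs_sum legs_tensor cl)
  also have "Rsum V3 (\<lambda>x y z. Rsum V3 (\<lambda>a b c. tensor k V [l a (r w b), l z u, l c (l x (r v y))])) = \<Omega>13 (\<Omega>12 (tensor k V [u, v, w]))"
    by (simp only: legs_tensor uvw, rule sym) (intro legs_sum legs_tensor cl)
  finally show ?thesis .
qed

text \<open>
  The left side loses its last copy of \<open>R\<close> by absorption. On the right the copy \<open>(a, b, c)\<close> of the middle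
  leg is the one that acts on a factor \<open>R\<^sup>1 \<cdot> R\<^sup>2\<close> and is absorbed. To meet \<open>R_absorb\<close>, whose inner sum
  is the absorbed one, the sums are reordered, and a unit is inserted where absorption has to leave
  an element of \<open>A\<close>.
\<close>

lemma braid_tensor:
  assumes uvw: "u \<in> carrier V" "v \<in> carrier V" "w \<in> carrier V"
  shows "\<Omega>12 (\<Omega>23 (\<Omega>12 (tensor k V [u, v, w]))) = \<Omega>23 (\<Omega>12 (\<Omega>23 (tensor k V [u, v, w])))"
proof -
  note cl = V_closed uvw
  have "\<Omega>23 (\<Omega>12 (tensor k V [u, v, w])) =
      Rsum V3 (\<lambda>x y z. Rsum V3 (\<lambda>a b c. tensor k V [l x (r v y), l a (r w b), l c (l z u)]))"
    by (simp only: legs_tensor uvw) (intro legs_sum legs_tensor cl)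
  then have "\<Omega>12 (\<Omega>23 (\<Omega>12 (tensor k V [u, v, w]))) =
      \<Omega>12 (Rsum V3 (\<lambda>x y z. Rsum V3 (\<lambda>a b c. tensor k V [l x (r v y), l a (r w b), l c (l z u)])))"
    by (rule arg_cong)
  also have "\<dots> =
      Rsum V3 (\<lambda>x y z. Rsum V3 (\<lambda>a b c. Rsum V3 (\<lambda>s t q.
        tensor k V [l s (r (l a (r w b)) t), l q (l x (r v y)), l c (l z u)])))"
    by (intro legs_sum legs_tensor cl)
  also have "\<dots> = Rsum V3 (\<lambda>x y z. Rsum V3 (\<lambda>a b c. Rsum V3 (\<lambda>s t q.
        tensor k V [l s (l \<one>\<^bsub>A\<^esub> (l a (r (r w b) t))), l q (l x (r v y)), l c (l z u)])))"
    by (intro R.sum_cong[OF module_V3] cl) (simp_all add: action_simps l_one uvw)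
  also have "\<dots> = Rsum V3 (\<lambda>x y z. Rsum V3 (\<lambda>a b c.
        tensor k V [l a (r w b), l \<one>\<^bsub>A\<^esub> (l x (r v y)), l c (l z u)]))"
    by (intro R.sum_cong[OF module_V3]
        R_absorb[OF module_V3, of "\<lambda>m q c. tensor k V [m, l q (l x (r v y)), l c (l z u)]" for x y z])
      (auto intro!: trilinearI V_homs cl)
  also have "\<dots> = Rsum V3 (\<lambda>x y z. Rsum V3 (\<lambda>a b c.
        tensor k V [l a (r w b), l x (r v y), l c (l z u)]))"
    by (intro R.sum_cong[OF module_V3] cl) (simp_all add: action_simps l_one uvw)
  also have "\<dots> = Rsum V3 (\<lambda>a b c. Rsum V3 (\<lambda>x y z.
        tensor k V [l a (r w b), l x (r v y), l c (l z u)]))"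
    by (rule sum3_swap[OF R_sum R_sum module_V3]) (auto intro!: cl)
  also have "\<dots> = Rsum V3 (\<lambda>s t q. Rsum V3 (\<lambda>x y z.
        tensor k V [l x (r w y), l s (l z (r v t)), l q u]))"
    by (rule two_normal_forms_agree[OF uvw, symmetric])
  also have "\<dots> = Rsum V3 (\<lambda>s t q. Rsum V3 (\<lambda>x y z.
        tensor k V [l x (r w y), l s (l z (r v t)), l q (l \<one>\<^bsub>A\<^esub> u)]))"
    by (intro R.sum_cong[OF module_V3] cl) (simp_all add: l_one uvw)
  also have "\<dots> = Rsum V3 (\<lambda>s t q. Rsum V3 (\<lambda>x y z. Rsum V3 (\<lambda>a b c.
        tensor k V [l a (l \<one>\<^bsub>A\<^esub> (l x (r (r w y) b))), l s (l z (r v t)), l q (l c u)])))"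
    by (intro R.sum_cong[OF module_V3]
        R_absorb[OF module_V3, of "\<lambda>m c z. tensor k V [m, l s (l z (r v t)), l q (l c u)]" for s t q, symmetric])
      (auto intro!: trilinearI V_homs cl)
  also have "\<dots> = Rsum V3 (\<lambda>x y z. Rsum V3 (\<lambda>s t q. Rsum V3 (\<lambda>a b c.
        tensor k V [l a (l \<one>\<^bsub>A\<^esub> (l x (r (r w y) b))), l s (l z (r v t)), l q (l c u)])))"
    by (rule sum3_swap[OF R_sum R_sum module_V3]) (auto intro!: cl)
  also have "\<dots> = Rsum V3 (\<lambda>x y z. Rsum V3 (\<lambda>a b c. Rsum V3 (\<lambda>s t q.
        tensor k V [l a (l \<one>\<^bsub>A\<^esub> (l x (r (r w y) b))), l s (l z (r v t)), l q (l c u)])))"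
    by (intro R.sum_cong[OF module_V3] sum3_swap[OF R_sum R_sum module_V3]) (auto intro!: cl)
  also have "\<dots> = Rsum V3 (\<lambda>x y z. Rsum V3 (\<lambda>a b c. Rsum V3 (\<lambda>s t q.
        tensor k V [l a (r (l x (r w y)) b), l s (r (l z v) t), l q (l c u)])))"
    by (intro R.sum_cong[OF module_V3] cl) (simp_all add: action_simps l_one uvw)
  also have "\<dots> = \<Omega>23 (Rsum V3 (\<lambda>x y z. Rsum V3 (\<lambda>a b c. tensor k V [l a (r (l x (r w y)) b), l c u, l z v])))"
    by (rule sym) (intro legs_sum legs_tensor cl)
  also have "Rsum V3 (\<lambda>x y z. Rsum V3 (\<lambda>a b c. tensor k V [l a (r (l x (r w y)) b), l c u, l z v])) = \<Omega>12 (\<Omega>23 (tensor k V [u, v, w]))"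
    by (simp only: legs_tensor uvw, rule sym) (intro legs_sum legs_tensor cl)
  finally show ?thesis .
qed

text \<open>
  Absorption with \<open>a = r\<^sup>3\<close> leaves \<open>R\<^sup>1 w R\<^sup>2 \<otimes> r\<^sup>3r\<^sup>1R\<^sup>3 v r\<^sup>2\<close>, and \<open>r\<^sup>3r\<^sup>1 \<otimes> r\<^sup>2 = 1 \<otimes> 1\<close>.
\<close>

lemma Omega_cubed_tensor:
  assumes vw: "v \<in> carrier V" "w \<in> carrier V"
  shows "\<Omega> (\<Omega> (\<Omega> (tensor k V [v, w]))) = \<Omega> (tensor k V [v, w])"
proof -
  note cl = V_closed vw
  have "\<Omega> (\<Omega> (tensor k V [v, w])) =
      Rsum V2 (\<lambda>x y z. Rsum V2 (\<lambda>a b c. tensor k V [l a (r (l z v) b), l c (l x (r w y))]))"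
    by (simp only: Omega_tensor vw) (intro legs_sum Omega_tensor cl)
  then have "\<Omega> (\<Omega> (\<Omega> (tensor k V [v, w]))) =
      \<Omega> (Rsum V2 (\<lambda>x y z. Rsum V2 (\<lambda>a b c. tensor k V [l a (r (l z v) b), l c (l x (r w y))])))"
    by (rule arg_cong)
  also have "\<dots> =
      Rsum V2 (\<lambda>x y z. Rsum V2 (\<lambda>a b c. Rsum V2 (\<lambda>s t q.
        tensor k V [l s (r (l c (l x (r w y))) t), l q (l a (r (l z v) b))])))"
    by (intro legs_sum Omega_tensor cl)
  also have "\<dots> = Rsum V2 (\<lambda>a b c. Rsum V2 (\<lambda>x y z. Rsum V2 (\<lambda>s t q.
        tensor k V [l s (r (l c (l x (r w y))) t), l q (l a (r (l z v) b))])))"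
    by (rule sum3_swap[OF R_sum R_sum module_V2]) (auto intro!: cl)
  also have "\<dots> = Rsum V2 (\<lambda>a b c. Rsum V2 (\<lambda>x y z. Rsum V2 (\<lambda>s t q.
        tensor k V [l s (l c (l x (r (r w y) t))), l q (l a (l z (r v b)))])))"
    by (intro R.sum_cong[OF module_V2] cl) (simp_all add: action_simps vw)
  also have "\<dots> = Rsum V2 (\<lambda>a b c. Rsum V2 (\<lambda>x y z.
        tensor k V [l x (r w y), l c (l a (l z (r v b)))]))"
    by (intro R.sum_cong[OF module_V2]
        R_absorb[OF module_V2, of "\<lambda>m q z. tensor k V [m, l q (l a (l z (r v b)))]" for a b])
      (auto intro!: trilinearI V_homs cl)
  also have "\<dots> = Rsum V2 (\<lambda>x y z. Rsum V2 (\<lambda>a b c.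
        tensor k V [l x (r w y), l c (l a (l z (r v b)))]))"
    by (rule sum3_swap[OF R_sum R_sum module_V2]) (auto intro!: cl)
  also have "\<dots> = Rsum V2 (\<lambda>x y z. Rsum V2 (\<lambda>a b c.
        tensor k V [l x (r w y), l (c \<otimes>\<^bsub>A\<^esub> a) (l z (r v b))]))"
    by (intro R.sum_cong[OF module_V2] cl) (simp_all add: action_simps vw)
  also have "\<dots> = Rsum V2 (\<lambda>x y z. tensor k V [l x (r w y), l \<one>\<^bsub>A\<^esub> (l z (r v \<one>\<^bsub>A\<^esub>))])"
    by (intro R.sum_cong[OF module_V2]
        R_third_times_first[OF module_V2, of "\<lambda>m b. tensor k V [l x (r w y), l m (l z (r v b))]" for x y z])
      (auto intro!: bilinearI V_homs cl)
  also have "\<dots> = \<Omega> (tensor k V [v, w])"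
    unfolding Omega_tensor[OF vw]
    by (intro R.sum_cong[OF module_V2] cl) (simp_all add: action_simps l_one r_one vw)
  finally show ?thesis .
qed

end

theorem theorem2p13:
  fixes k :: "('k, 'x) ring_scheme" and A :: "('k, 'a, 'y) module_scheme"
    and V :: "('k, 'v, 'z) module_scheme"
    and l :: "'a \<Rightarrow> 'v \<Rightarrow> 'v" and r :: "'v \<Rightarrow> 'a \<Rightarrow> 'v"
    and R :: "('a list \<Rightarrow> 'k) set"
  assumes "cring k"
    and "assoc_algebra k A"
    and "canonical_R_matrix k A R"
    and "bimodule k A V l r"
  shows "let V2 = tensor_power k V 2; V3 = tensor_power k V 3;
      \<Omega> = Omega k V l r R;
      \<Omega>12 = leg k V 1 2 \<Omega>; \<Omega>13 = leg k V 1 3 \<Omega>; \<Omega>23 = leg k V 2 3 \<Omega>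
    in \<Omega> \<in> module_hom k V2 V2 \<and>
      (\<forall>v\<in>carrier V. \<forall>w\<in>carrier V. \<Omega> (tensor k V [v, w]) =
        sweedler3 k V2 (\<lambda>R1 R2 R3. tensor k V [r (l R1 w) R2, l R3 v]) R) \<and>
      \<Omega>12 \<in> module_hom k V3 V3 \<and> \<Omega>13 \<in> module_hom k V3 V3 \<and> \<Omega>23 \<in> module_hom k V3 V3 \<and>
      (\<forall>t\<in>carrier V3. (\<Omega>12 \<circ> \<Omega>13 \<circ> \<Omega>23) t = (\<Omega>23 \<circ> \<Omega>13 \<circ> \<Omega>12) t) \<and>
      (\<forall>t\<in>carrier V3. (\<Omega>12 \<circ> \<Omega>23 \<circ> \<Omega>12) t = (\<Omega>23 \<circ> \<Omega>12 \<circ> \<Omega>23) t) \<and>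
      (\<forall>t\<in>carrier V2. (\<Omega> \<circ> \<Omega> \<circ> \<Omega>) t = \<Omega> t)"
proof -
  interpret A: assoc_algebra k A by fact
  have module_A: "module k A" by (rule A.module_axioms)
  have "R \<in> Units (tensor_power_algebra k A 3)"
    using assms(3) by (simp add: canonical_R_matrix_def Let_def)
  then obtain S where R_mem: "R \<in> carrier (tensor_power k A 3)"
    and S_mem: "S \<in> carrier (tensor_power k A 3)"
    and inverse: "R \<otimes>\<^bsub>tensor_power_algebra k A 3\<^esub> S = \<one>\<^bsub>tensor_power_algebra k A 3\<^esub>"
    by (auto simp: Units_def tensor_power_algebra_def)
  obtain I :: "'a list set" and p where Ip: "finite I" "p \<in> I \<rightarrow> tuples A 3"
    "R = (\<Oplus>\<^bsub>tensor_power k A 3\<^esub>i\<in>I. tensor k A (p i))"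
    using tensor_power_sum_of_tensors[OF module_A R_mem zero_less_numeral] .
  obtain J :: "'a list set" and q where Jq: "finite J" "q \<in> J \<rightarrow> tuples A 3"
    "S = (\<Oplus>\<^bsub>tensor_power k A 3\<^esub>i\<in>J. tensor k A (q i))"
    using tensor_power_sum_of_tensors[OF module_A S_mem zero_less_numeral] .
  have R_sum: "tensor3_sum k A I p R" and S_sum: "tensor3_sum k A J q S"
    using Ip Jq by (simp_all add: tensor3_sum_def tensor3_sum_axioms_def module_A)
  interpret canonical_R_bimodule k A I p R J q S V l r
    by (intro canonical_R_bimodule.intro canonical_R.intro canonical_R_axioms.intro
        assms R_sum S_sum inverse)
  note homs = Omega_hom Omega12_hom Omega13_hom Omega23_hom
  have ext3: "f t = g t"
    if "f \<in> module_hom k V3 V3" "g \<in> module_hom k V3 V3" "t \<in> carrier V3"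
      and eq: "\<And>u v w. \<lbrakk>u \<in> carrier V; v \<in> carrier V; w \<in> carrier V\<rbrakk> \<Longrightarrow>
        f (tensor k V [u, v, w]) = g (tensor k V [u, v, w])" for f g t
  proof (rule tensor_hom_ext[OF module_V module_V3 that(1,2) _ that(3)])
    fix xs assume xs: "xs \<in> tuples V 3"
    show "f (tensor k V xs) = g (tensor k V xs)"
      using eq[of "xs ! 0" "xs ! 1" "xs ! 2", folded tuples3_eq[OF xs]] tuples_nth[OF xs] by simp
  qed
  have yang_baxter: "\<Omega>12 (\<Omega>13 (\<Omega>23 t)) = \<Omega>23 (\<Omega>13 (\<Omega>12 t))" if "t \<in> carrier V3" for t
    by (rule ext3[of "\<lambda>t. \<Omega>12 (\<Omega>13 (\<Omega>23 t))" "\<lambda>t. \<Omega>23 (\<Omega>13 (\<Omega>12 t))", OF _ _ that])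
      (rule module_hom_comp[OF module_hom_comp[OF Omega23_hom Omega13_hom] Omega12_hom]
        module_hom_comp[OF module_hom_comp[OF Omega12_hom Omega13_hom] Omega23_hom]
        yang_baxter_tensor; assumption)+
  have braid: "\<Omega>12 (\<Omega>23 (\<Omega>12 t)) = \<Omega>23 (\<Omega>12 (\<Omega>23 t))" if "t \<in> carrier V3" for t
    by (rule ext3[of "\<lambda>t. \<Omega>12 (\<Omega>23 (\<Omega>12 t))" "\<lambda>t. \<Omega>23 (\<Omega>12 (\<Omega>23 t))", OF _ _ that])
      (rule module_hom_comp[OF module_hom_comp[OF Omega12_hom Omega23_hom] Omega12_hom]
        module_hom_comp[OF module_hom_comp[OF Omega23_hom Omega12_hom] Omega23_hom]
        braid_tensor; assumption)+
  have cubed: "\<Omega> (\<Omega> (\<Omega> t)) = \<Omega> t" if t: "t \<in> carrier V2" for t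
  proof (rule tensor_hom_ext[OF module_V module_V2 _ Omega_hom _ t])
    show "(\<lambda>t. \<Omega> (\<Omega> (\<Omega> t))) \<in> module_hom k V2 V2"
      by (rule module_hom_comp[OF module_hom_comp[OF Omega_hom Omega_hom] Omega_hom])
    fix xs assume xs: "xs \<in> tuples V 2"
    show "\<Omega> (\<Omega> (\<Omega> (tensor k V xs))) = \<Omega> (tensor k V xs)"
      using Omega_cubed_tensor[of "xs ! 0" "xs ! 1", folded tuples2_eq[OF xs]] tuples_nth[OF xs]
      by simp
  qed
  show ?thesis
    unfolding Let_def comp_def
    using homs yang_baxter braid cubed by (simp add: Omega_tensor Omega_summand)
qed

end
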